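(* Let $\mathcal{M}$ be an unbounded graph matroid family. Then $\mathcal{M}$ has the Whitney property if and only if it has the Lovász-Yemini property.
   Context: All graphs are finite and simple (no loops, no parallel edges) and have no isolated vertices; vertex sets are drawn from a fixed countable set such as $\mathbb{N}$. A graph matroid family $\mathcal{M}$ assigns to every such graph $G$ a matroid $\mathcal{M}(G)$ on ground set $E(G)$ such that (i) every graph isomorphism $V(G)\to V(H)$ induces (via its action on edges) an isomorphism $\mathcal{M}(G)\to\mathcal{M}(H)$, and (ii) for every subgraph $H$ of $G$, $\mathcal{M}(H)$ is the restriction of $\mathcal{M}(G)$ to $E(H)$. Write $r(G)$ for the rank of $\mathcal{M}(G)$. A graph $G$ is $\mathcal{M}$-rigid if $r(G)=r(K_{V(G)})$, where $K_V$ is the complete graph on $V$. $\mathcal{M}$ is unbounded if $r(K_n)$ is unbounded as $n\to\infty$. A graph $G$ is $\mathcal{M}$-reconstructible if for every graph $H$ and every matroid isomorphism $\psi:E(G)\to E(H)$ between $\mathcal{M}(G)$ and $\mathcal{M}(H)$, there is a graph isomorphism $\varphi:V(G)\to V(H)$ with $\psi(uv)=\varphi(u)\varphi(v)$ for all $uv\in E(G)$. $\mathcal{M}$ has the Whitney property if there is a nonnegative integer $c$ such that every $c$-connected graph is $\mathcal{M}$-reconstructible; it has the Lovász-Yemini property if there is a nonnegative integer $c$ such that every $c$-connected graph is $\mathcal{M}$-rigid. *)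

theory Defs
  imports Main
begin

text \<open>A graph (finite, simple, no isolated vertices, vertices in nat) is represented
by its edge set: a finite set of 2-element subsets of nat. Its vertex set is the
union of its edges.\<close>

type_synonym graph = "nat set set"

definition is_graph :: "graph \<Rightarrow> bool" where
  "is_graph G \<longleftrightarrow> finite G \<and> (\<forall>e\<in>G. card e = 2)"

definition verts :: "graph \<Rightarrow> nat set" where
  "verts G = \<Union>G"

definition complete_graph :: "nat set \<Rightarrow> graph" where
  "complete_graph V = {{u, v} | u v. u \<in> V \<and> v \<in> V \<and> u \<noteq> v}"

text \<open>Graph isomorphism V(G) -> V(H).\<close>
definition graph_iso :: "(nat \<Rightarrow> nat) \<Rightarrow> graph \<Rightarrow> graph \<Rightarrow> bool" where
  "graph_iso f G H \<longleftrightarrow> bij_betw f (verts G) (verts H) \<and> (\<lambda>e. f ` e) ` G = H"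

text \<open>Matroid on finite ground set E given by its independence predicate.\<close>
definition matroid :: "'a set \<Rightarrow> ('a set \<Rightarrow> bool) \<Rightarrow> bool" where
  "matroid E indep \<longleftrightarrow> finite E \<and> indep {} \<and>
     (\<forall>X. indep X \<longrightarrow> X \<subseteq> E) \<and>
     (\<forall>X Y. indep X \<and> Y \<subseteq> X \<longrightarrow> indep Y) \<and>
     (\<forall>X Y. indep X \<and> indep Y \<and> card X < card Y \<longrightarrow> (\<exists>y\<in>Y - X. indep (insert y X)))"

definition matroid_iso :: "('a \<Rightarrow> 'b) \<Rightarrow> 'a set \<Rightarrow> ('a set \<Rightarrow> bool) \<Rightarrow> 'b set \<Rightarrow> ('b set \<Rightarrow> bool) \<Rightarrow> bool" where
  "matroid_iso \<psi> E1 I1 E2 I2 \<longleftrightarrow> bij_betw \<psi> E1 E2 \<and> (\<forall>X. X \<subseteq> E1 \<longrightarrow> (I1 X \<longleftrightarrow> I2 (\<psi> ` X)))"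

text \<open>A graph matroid family: M G is the independence predicate of the matroid M(G).\<close>
definition graph_matroid_family :: "(graph \<Rightarrow> nat set set \<Rightarrow> bool) \<Rightarrow> bool" where
  "graph_matroid_family M \<longleftrightarrow>
     (\<forall>G. is_graph G \<longrightarrow> matroid G (M G)) \<and>
     (\<forall>G H f. is_graph G \<and> is_graph H \<and> graph_iso f G H \<longrightarrow>
        matroid_iso (\<lambda>e. f ` e) G (M G) H (M H)) \<and>
     (\<forall>G H. is_graph G \<and> H \<subseteq> G \<longrightarrow> (\<forall>X. M H X \<longleftrightarrow> X \<subseteq> H \<and> M G X))"

definition rank :: "(graph \<Rightarrow> nat set set \<Rightarrow> bool) \<Rightarrow> graph \<Rightarrow> nat" where
  "rank M G = Max {card X | X. X \<subseteq> G \<and> M G X}"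

definition rigid :: "(graph \<Rightarrow> nat set set \<Rightarrow> bool) \<Rightarrow> graph \<Rightarrow> bool" where
  "rigid M G \<longleftrightarrow> rank M G = rank M (complete_graph (verts G))"

definition unbounded :: "(graph \<Rightarrow> nat set set \<Rightarrow> bool) \<Rightarrow> bool" where
  "unbounded M \<longleftrightarrow> (\<forall>B. \<exists>n. rank M (complete_graph {0..<n}) > B)"

definition reconstructible :: "(graph \<Rightarrow> nat set set \<Rightarrow> bool) \<Rightarrow> graph \<Rightarrow> bool" where
  "reconstructible M G \<longleftrightarrow>
     (\<forall>H \<psi>. is_graph H \<and> matroid_iso \<psi> G (M G) H (M H) \<longrightarrow>
        (\<exists>\<phi>. graph_iso \<phi> G H \<and> (\<forall>u v. {u, v} \<in> G \<longrightarrow> \<psi> {u, v} = {\<phi> u, \<phi> v})))"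

text \<open>Connectivity of the subgraph of G induced on W.\<close>
definition connected_on :: "nat set \<Rightarrow> graph \<Rightarrow> bool" where
  "connected_on W G \<longleftrightarrow>
     (\<forall>u\<in>W. \<forall>v\<in>W. (u, v) \<in> {(x, y). x \<in> W \<and> y \<in> W \<and> {x, y} \<in> G}\<^sup>*)"

text \<open>c-connected: at least c+1 vertices, and deleting fewer than c vertices leaves a connected graph.\<close>
definition k_connected :: "nat \<Rightarrow> graph \<Rightarrow> bool" where
  "k_connected c G \<longleftrightarrow> card (verts G) \<ge> c + 1 \<and>
     (\<forall>X. X \<subseteq> verts G \<and> card X < c \<longrightarrow> connected_on (verts G - X) G)"

definition whitney_property :: "(graph \<Rightarrow> nat set set \<Rightarrow> bool) \<Rightarrow> bool" where
  "whitney_property M \<longleftrightarrow> (\<exists>c. \<forall>G. is_graph G \<and> k_connected c G \<longrightarrow> reconstructible M G)"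

definition lovasz_yemini_property :: "(graph \<Rightarrow> nat set set \<Rightarrow> bool) \<Rightarrow> bool" where
  "lovasz_yemini_property M \<longleftrightarrow> (\<exists>c. \<forall>G. is_graph G \<and> k_connected c G \<longrightarrow> rigid M G)"

end

theory Submission
  imports Defs
begin

text \<open>
  Whitney implies Lovasz-Yemini: if a highly connected graph \<open>G\<close> is not rigid, then, since a
  large complete graph minus an edge still spans, there are two edges \<open>f \<noteq> f'\<close> on \<open>verts G\<close>
  outside the closure of \<open>G\<close>. The map fixing \<open>G\<close> and sending \<open>f\<close> to \<open>f'\<close> is a matroid isomorphism
  \<open>G + f \<rightarrow> G + f'\<close>, but a vertex map fixing all edges of \<open>G\<close> is the identity.

  Lovasz-Yemini implies Whitney: the increments of \<open>r (K\<^sub>n)\<close> are eventually a constant \<open>d \<ge> 1\<close>, and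
  by symmetry attaching a new vertex by \<open>k\<close> edges to any graph raises the rank by at least
  \<open>min d k\<close>. Hence, if the edges of a highly connected \<open>G\<close> are split into \<open>A\<close> and \<open>B\<close>, every vertex
  of a small set \<open>W\<close> sending both an \<open>A\<close>-edge and a \<open>B\<close>-edge out of \<open>W\<close> contributes \<open>1\<close> to
  \<open>r A + r B - r G\<close>; so if this excess is bounded, one of \<open>A\<close>, \<open>B\<close> has few vertices. A graph \<open>H\<close>
  with the same matroid therefore has large minimum degree and no small vertex cut, hence is
  rigid and has as many vertices as \<open>G\<close>. The same applies to \<open>G - v\<close>, so the image of the star of
  \<open>v\<close> is the set of edges of \<open>H\<close> at the unique vertex lost from \<open>H\<close>.
\<close>

section \<open>Graphs given by their edge sets\<close>

definition star :: "nat \<Rightarrow> nat set \<Rightarrow> graph" where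
  "star w S = (\<lambda>u. {w, u}) ` S"

definition nbhd :: "graph \<Rightarrow> nat \<Rightarrow> nat set" where
  "nbhd G v = {u. {v, u} \<in> G}"

text \<open>As a graph is its edge set, vertices isolated by the deletion vanish as well;
  \<open>verts_del_verts\<close> excludes this for sufficiently connected graphs.\<close>

definition del_verts :: "graph \<Rightarrow> nat set \<Rightarrow> graph" where
  "del_verts G Y = {e \<in> G. e \<inter> Y = {}}"

lemma is_graph_subset: "is_graph G \<Longrightarrow> H \<subseteq> G \<Longrightarrow> is_graph H"
  unfolding is_graph_def using finite_subset by blast

lemma is_graph_Un: "is_graph G \<Longrightarrow> is_graph H \<Longrightarrow> is_graph (G \<union> H)"
  unfolding is_graph_def by auto

lemma is_graph_insert: "is_graph G \<Longrightarrow> card e = 2 \<Longrightarrow> is_graph (insert e G)"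
  unfolding is_graph_def by auto

lemma is_graph_UN: "finite W \<Longrightarrow> (\<And>w. w \<in> W \<Longrightarrow> is_graph (F w)) \<Longrightarrow> is_graph (\<Union>w\<in>W. F w)"
  unfolding is_graph_def by auto

lemma is_graph_edgeE:
  assumes "is_graph G" "e \<in> G"
  obtains u v where "e = {u, v}" "u \<noteq> v"
  using assms unfolding is_graph_def by (metis card_2_iff)

lemma finite_verts: "is_graph G \<Longrightarrow> finite (verts G)"
  unfolding is_graph_def verts_def by (metis card.infinite finite_Union zero_neq_numeral)

lemma is_graph_complete: "finite V \<Longrightarrow> is_graph (complete_graph V)"
proof -
  assume "finite V"
  then have "finite ((\<lambda>(u, v). {u, v}) ` (V \<times> V))" by simp
  moreover have "complete_graph V \<subseteq> (\<lambda>(u, v). {u, v}) ` (V \<times> V)"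
    unfolding complete_graph_def by auto
  ultimately have "finite (complete_graph V)" by (rule finite_subset[rotated])
  then show ?thesis unfolding is_graph_def complete_graph_def by auto
qed

lemma is_graph_star: "finite S \<Longrightarrow> w \<notin> S \<Longrightarrow> is_graph (star w S)"
  unfolding is_graph_def star_def by (auto simp: card_insert_if)

lemma subset_complete: "is_graph G \<Longrightarrow> verts G \<subseteq> V \<Longrightarrow> G \<subseteq> complete_graph V"
proof
  fix e assume "is_graph G" "verts G \<subseteq> V" "e \<in> G"
  moreover from this obtain u v where "e = {u, v}" "u \<noteq> v" by (metis is_graph_edgeE)
  ultimately show "e \<in> complete_graph V" unfolding complete_graph_def verts_def by blast
qed

lemma verts_complete_subset: "verts (complete_graph V) \<subseteq> V"
  unfolding verts_def complete_graph_def by auto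

lemma complete_graph_mono: "U \<subseteq> V \<Longrightarrow> complete_graph U \<subseteq> complete_graph V"
  unfolding complete_graph_def by auto

lemma complete_insert: "w \<notin> V \<Longrightarrow> complete_graph (insert w V) = complete_graph V \<union> star w V"
  unfolding complete_graph_def star_def by (auto simp: doubleton_eq_iff)

lemma image_complete:
  assumes "inj_on f V"
  shows "(\<lambda>e. f ` e) ` complete_graph V = complete_graph (f ` V)"
proof (intro equalityI subsetI)
  fix e assume "e \<in> (\<lambda>e. f ` e) ` complete_graph V"
  then obtain u v where "u \<in> V" "v \<in> V" "u \<noteq> v" "e = {f u, f v}"
    unfolding complete_graph_def by auto
  moreover from this have "f u \<noteq> f v" using assms by (meson inj_on_def)
  ultimately show "e \<in> complete_graph (f ` V)" unfolding complete_graph_def by blast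
next
  fix e assume "e \<in> complete_graph (f ` V)"
  then obtain u v where uv: "u \<in> V" "v \<in> V" "f u \<noteq> f v" "e = {f u, f v}"
    unfolding complete_graph_def by auto
  then have "{u, v} \<in> complete_graph V" unfolding complete_graph_def by blast
  moreover have "e = f ` {u, v}" using uv by simp
  ultimately show "e \<in> (\<lambda>e. f ` e) ` complete_graph V" by blast
qed

lemma star_nbhd: "star w (nbhd F w) \<subseteq> F"
  unfolding star_def nbhd_def by auto

lemma star_mono: "S \<subseteq> T \<Longrightarrow> star w S \<subseteq> star w T"
  unfolding star_def by auto

lemma verts_mono: "G \<subseteq> H \<Longrightarrow> verts G \<subseteq> verts H"
  unfolding verts_def by auto

lemma nbhd_subset: "nbhd G v \<subseteq> verts G"
  unfolding nbhd_def verts_def by auto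

lemma nbhd_not_self: "is_graph G \<Longrightarrow> v \<notin> nbhd G v"
  unfolding nbhd_def is_graph_def by fastforce

lemma nbhd_Un: "nbhd (A \<union> B) v = nbhd A v \<union> nbhd B v"
  unfolding nbhd_def by auto

lemma finite_nbhd: "is_graph G \<Longrightarrow> finite (nbhd G v)"
  using finite_subset[OF nbhd_subset finite_verts] .

lemma split_at_vertex:
  assumes "is_graph H"
  shows "H = del_verts H {w} \<union> star w (nbhd H w)"
proof (intro equalityI subsetI)
  fix e assume e: "e \<in> H"
  show "e \<in> del_verts H {w} \<union> star w (nbhd H w)"
  proof (cases "w \<in> e")
    case True
    then obtain x where "e = {w, x}"
      using is_graph_edgeE[OF assms e] by (metis doubleton_eq_iff insertE singletonD)
    then show ?thesis using e unfolding star_def nbhd_def by auto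
  next
    case False
    then show ?thesis using e unfolding del_verts_def by auto
  qed
next
  fix e assume "e \<in> del_verts H {w} \<union> star w (nbhd H w)"
  then show "e \<in> H" using star_nbhd[of w H] unfolding del_verts_def by blast
qed

lemma card_edges_le:
  assumes "is_graph G"
  shows "card G \<le> card (verts G) * card (verts G)"
proof -
  let ?P = "verts G \<times> verts G"
  have "G \<subseteq> (\<lambda>(u, v). {u, v}) ` ?P"
  proof
    fix e assume "e \<in> G"
    moreover from this obtain u v where "e = {u, v}" using assms by (metis is_graph_edgeE)
    ultimately have "(u, v) \<in> ?P" unfolding verts_def by blast
    then show "e \<in> (\<lambda>(u, v). {u, v}) ` ?P" using \<open>e = {u, v}\<close> by force
  qed
  then have "card G \<le> card ((\<lambda>(u, v). {u, v}) ` ?P)"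
    using finite_verts[OF assms] by (intro card_mono) auto
  also have "\<dots> \<le> card ?P" using finite_verts[OF assms] by (intro card_image_le) auto
  finally show ?thesis by (simp add: card_cartesian_product)
qed

lemma card_star: "card (star w S) = card S"
proof -
  have "inj_on (\<lambda>u. {w, u}) S" unfolding inj_on_def by (auto simp: doubleton_eq_iff)
  then show ?thesis unfolding star_def by (rule card_image)
qed

lemma ex_mem_not_in: "finite A \<Longrightarrow> card A < card B \<Longrightarrow> \<exists>x\<in>B. x \<notin> A"
  by (metis card_mono linorder_not_less subsetI)

lemma two_distinct:
  assumes "2 \<le> card A"
  obtains x y where "x \<in> A" "y \<in> A" "x \<noteq> y"
proof -
  obtain B where "B \<subseteq> A" "card B = 2" using obtain_subset_with_card_n[OF assms] by blast
  then show ?thesis using that by (auto simp: card_2_iff)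
qed

subsection \<open>Connectivity\<close>

lemma connected_on_neighbour:
  assumes "connected_on W G" "u \<in> W" "v \<in> W" "u \<noteq> v"
  obtains y where "y \<in> W" "{u, y} \<in> G"
proof -
  have "(u, v) \<in> {(x, y). x \<in> W \<and> y \<in> W \<and> {x, y} \<in> G}\<^sup>*"
    using assms unfolding connected_on_def by blast
  then show ?thesis using assms(4) that by (cases rule: converse_rtranclE) auto
qed

lemma connected_on_del_verts:
  assumes "W \<inter> Y = {}"
  shows "connected_on W (del_verts G Y) \<longleftrightarrow> connected_on W G"
proof -
  have "{(x, y). x \<in> W \<and> y \<in> W \<and> {x, y} \<in> del_verts G Y} = {(x, y). x \<in> W \<and> y \<in> W \<and> {x, y} \<in> G}"
    using assms unfolding del_verts_def by auto
  then show ?thesis unfolding connected_on_def by simp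
qed

lemma connected_on_mono:
  assumes "connected_on W G" "G \<subseteq> H"
  shows "connected_on W H"
proof -
  have "{(x, y). x \<in> W \<and> y \<in> W \<and> {x, y} \<in> G} \<subseteq> {(x, y). x \<in> W \<and> y \<in> W \<and> {x, y} \<in> H}"
    using assms(2) by auto
  then have "{(x, y). x \<in> W \<and> y \<in> W \<and> {x, y} \<in> G}\<^sup>* \<subseteq> {(x, y). x \<in> W \<and> y \<in> W \<and> {x, y} \<in> H}\<^sup>*"
    by (rule rtrancl_mono)
  then show ?thesis using assms(1) unfolding connected_on_def by blast
qed

lemma connected_on_invariant:
  assumes "connected_on W G" "u \<in> W" "v \<in> W" "P u"
    and step: "\<And>x y. x \<in> W \<Longrightarrow> y \<in> W \<Longrightarrow> {x, y} \<in> G \<Longrightarrow> P x \<Longrightarrow> P y"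
  shows "P v"
proof -
  have "(u, v) \<in> {(x, y). x \<in> W \<and> y \<in> W \<and> {x, y} \<in> G}\<^sup>*"
    using assms unfolding connected_on_def by blast
  then show ?thesis using \<open>P u\<close> by (induction rule: rtrancl_induct) (use step in auto)
qed

lemma not_connected_on_split:
  assumes "\<not> connected_on W G"
  obtains U where "U \<subseteq> W" "U \<noteq> {}" "W - U \<noteq> {}" "\<And>x y. x \<in> U \<Longrightarrow> y \<in> W - U \<Longrightarrow> {x, y} \<notin> G"
proof -
  let ?R = "{(x, y). x \<in> W \<and> y \<in> W \<and> {x, y} \<in> G}"
  from assms obtain u v where uv: "u \<in> W" "v \<in> W" "(u, v) \<notin> ?R\<^sup>*"
    unfolding connected_on_def by blast
  let ?U = "{x \<in> W. (u, x) \<in> ?R\<^sup>*}"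
  have "{x, y} \<notin> G" if "x \<in> ?U" "y \<in> W - ?U" for x y
  proof
    assume "{x, y} \<in> G"
    then have "(x, y) \<in> ?R" using that by auto
    then have "(u, y) \<in> ?R\<^sup>*" using that by (auto intro: rtrancl_into_rtrancl)
    then show False using that by auto
  qed
  moreover have "?U \<noteq> {}" "W - ?U \<noteq> {}" using uv by blast+
  ultimately show ?thesis by (intro that[of ?U]) blast+
qed

lemma k_connected_mono: "k_connected k G \<Longrightarrow> j \<le> k \<Longrightarrow> k_connected j G"
  unfolding k_connected_def by auto

text \<open>With fewer than \<open>k\<close> neighbours, deleting all of them would cut
  \<open>v\<close> off from another remaining vertex.\<close>

lemma k_connected_card_nbhd:
  assumes "is_graph G" "k_connected k G" "v \<in> verts G"
  shows "k \<le> card (nbhd G v)"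
proof (rule ccontr)
  assume "\<not> k \<le> card (nbhd G v)"
  then have lt: "card (nbhd G v) < k" by simp
  then have con: "connected_on (verts G - nbhd G v) G"
    using assms nbhd_subset unfolding k_connected_def by blast
  have "card (insert v (nbhd G v)) < card (verts G)"
    using lt assms(2) finite_nbhd[OF assms(1)] unfolding k_connected_def by (simp add: card_insert_if)
  then obtain u where "u \<in> verts G" "u \<notin> insert v (nbhd G v)"
    using ex_mem_not_in[of "insert v (nbhd G v)" "verts G"] finite_nbhd[OF assms(1)] by auto
  then obtain y where "y \<in> verts G - nbhd G v" "{v, y} \<in> G"
    using connected_on_neighbour[OF con, of v u] assms nbhd_not_self[OF assms(1)] by auto
  then show False unfolding nbhd_def by auto
qed

text \<open>A set of at most \<open>j\<close> vertices and one of fewer than \<open>k\<close>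
  together have fewer than \<open>k + j\<close>. As \<open>1 \<le> k\<close>, at least two vertices
  remain and they are connected, so none becomes isolated and drops out of
  \<open>verts\<close>.\<close>

lemma
  assumes "is_graph G" "k_connected (k + j) G" "1 \<le> k" "Y \<subseteq> verts G" "card Y \<le> j"
  shows verts_del_verts: "verts (del_verts G Y) = verts G - Y"
    and k_connected_del_verts: "k_connected k (del_verts G Y)"
proof -
  have fY: "finite Y" using assms finite_verts finite_subset by blast
  have con: "connected_on (verts G - (Y \<union> X)) G" if "X \<subseteq> verts G" "card X < k" for X
  proof -
    have "card (Y \<union> X) < k + j" using that assms(5) card_Un_le[of Y X] by linarith
    then show ?thesis using assms(2,4) that unfolding k_connected_def by auto
  qed
  have card: "k + 1 \<le> card (verts G - Y)"
    using assms(2,4,5) card_Diff_subset[OF fY assms(4)] unfolding k_connected_def by linarith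
  show v: "verts (del_verts G Y) = verts G - Y"
  proof
    show "verts (del_verts G Y) \<subseteq> verts G - Y" unfolding verts_def del_verts_def by auto
    show "verts G - Y \<subseteq> verts (del_verts G Y)"
    proof
      fix v assume v: "v \<in> verts G - Y"
      have "card {v} < card (verts G - Y)" using card assms(3) by simp
      then obtain u where "u \<in> verts G - Y" "u \<noteq> v"
        using ex_mem_not_in[of "{v}" "verts G - Y"] by auto
      then obtain y where "y \<in> verts G - Y" "{v, y} \<in> G"
        using connected_on_neighbour[of "verts G - Y" G v u] con[of "{}"] v assms(3) by auto
      then have "{v, y} \<in> del_verts G Y" using v unfolding del_verts_def by auto
      then show "v \<in> verts (del_verts G Y)" unfolding verts_def by blast
    qed
  qed
  have "connected_on (verts G - Y - X) (del_verts G Y)" if "X \<subseteq> verts G - Y" "card X < k" for X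
  proof -
    have "connected_on (verts G - (Y \<union> X)) G" using con that by blast
    moreover have "verts G - Y - X = verts G - (Y \<union> X)" by auto
    ultimately show ?thesis using connected_on_del_verts[of "verts G - (Y \<union> X)" Y G] by auto
  qed
  then show "k_connected k (del_verts G Y)" unfolding k_connected_def v using card by auto
qed

subsection \<open>Rank\<close>

locale graph_matroids =
  fixes M :: "graph \<Rightarrow> nat set set \<Rightarrow> bool"
  assumes family: "graph_matroid_family M"
begin

abbreviation r :: "graph \<Rightarrow> nat" where "r \<equiv> rank M"

text \<open>By restriction, independence of an edge set does not depend on the host graph, so it is
  tested in the matroid of the set itself; see \<open>M_iff_ind\<close>.\<close>

definition ind :: "graph \<Rightarrow> bool" where "ind X \<longleftrightarrow> M X X"

lemma M_iff_ind: "is_graph G \<Longrightarrow> M G X \<longleftrightarrow> X \<subseteq> G \<and> ind X"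
proof -
  assume G: "is_graph G"
  then have "M G X \<Longrightarrow> X \<subseteq> G" using family unfolding graph_matroid_family_def matroid_def by blast
  moreover have "X \<subseteq> G \<Longrightarrow> M X X \<longleftrightarrow> M G X" using family G unfolding graph_matroid_family_def by blast
  ultimately show ?thesis unfolding ind_def by blast
qed

lemma matroid: "is_graph G \<Longrightarrow> matroid G (M G)"
  using family unfolding graph_matroid_family_def by blast

lemma ind_empty: "ind {}"
  using matroid[of "{}"] M_iff_ind[of "{}"] unfolding matroid_def is_graph_def by blast

lemma ind_subset:
  assumes "is_graph X" "ind X" "Y \<subseteq> X"
  shows "ind Y"
proof -
  have "\<forall>Z Y. M X Z \<and> Y \<subseteq> Z \<longrightarrow> M X Y" using matroid[OF assms(1)] unfolding matroid_def by (elim conjE)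
  then have "M X Y" using assms unfolding ind_def by blast
  then show ?thesis using M_iff_ind[OF assms(1)] by simp
qed

lemma ind_augment:
  assumes "is_graph X" "is_graph Y" "ind X" "ind Y" "card X < card Y"
  shows "\<exists>y\<in>Y - X. ind (insert y X)"
proof -
  have "is_graph (X \<union> Y)" using assms is_graph_Un by blast
  then have "M (X \<union> Y) X" "M (X \<union> Y) Y" using M_iff_ind assms by auto
  moreover have "\<forall>Z Z'. M (X \<union> Y) Z \<and> M (X \<union> Y) Z' \<and> card Z < card Z' \<longrightarrow>
      (\<exists>y\<in>Z' - Z. M (X \<union> Y) (insert y Z))"
    using matroid[OF \<open>is_graph (X \<union> Y)\<close>] unfolding matroid_def by (elim conjE)
  ultimately obtain y where "y \<in> Y - X" "M (X \<union> Y) (insert y X)" using assms(5) by blast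
  then show ?thesis using M_iff_ind[OF \<open>is_graph (X \<union> Y)\<close>] by blast
qed

lemma rank_eq: "is_graph G \<Longrightarrow> r G = Max (card ` {X. X \<subseteq> G \<and> ind X})"
proof -
  assume "is_graph G"
  then have "{card X |X. X \<subseteq> G \<and> M G X} = card ` {X. X \<subseteq> G \<and> ind X}"
    using M_iff_ind by auto
  then show ?thesis unfolding rank_def by simp
qed

lemma card_le_rank: "is_graph G \<Longrightarrow> X \<subseteq> G \<Longrightarrow> ind X \<Longrightarrow> card X \<le> r G"
  unfolding rank_eq by (rule Max_ge) (auto simp: is_graph_def)

lemma ex_basis:
  assumes "is_graph G"
  obtains B where "B \<subseteq> G" "ind B" "card B = r G"
proof -
  have "r G \<in> card ` {X. X \<subseteq> G \<and> ind X}"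
    unfolding rank_eq[OF assms] using assms ind_empty
    by (intro Max_in) (auto simp: is_graph_def)
  then show ?thesis using that by auto
qed

lemma extend_to_basis:
  assumes "is_graph G" "X \<subseteq> G" "ind X"
  obtains B where "X \<subseteq> B" "B \<subseteq> G" "ind B" "card B = r G"
proof -
  let ?F = "{B. X \<subseteq> B \<and> B \<subseteq> G \<and> ind B}"
  have fin: "finite ?F" using assms(1) unfolding is_graph_def by auto
  have "?F \<noteq> {}" using assms by blast
  then have "Max (card ` ?F) \<in> card ` ?F" using fin by (intro Max_in) auto
  then obtain B where B: "B \<in> ?F" and "card B = Max (card ` ?F)" by auto
  then have max: "card B' \<le> card B" if "B' \<in> ?F" for B' using that fin by (simp del: mem_Collect_eq)
  obtain J where J: "J \<subseteq> G" "ind J" "card J = r G" using ex_basis[OF assms(1)] .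
  have "card B = r G"
  proof (rule ccontr)
    assume "card B \<noteq> r G"
    then have "card B < card J" using card_le_rank[OF assms(1), of B] B J by auto
    then obtain y where y: "y \<in> J - B" "ind (insert y B)"
      using ind_augment[of B J] B J is_graph_subset[OF assms(1)] by auto
    then have "insert y B \<in> ?F" using B J by auto
    then have "card (insert y B) \<le> card B" by (rule max)
    moreover have "card (insert y B) = Suc (card B)"
      using y B assms(1) finite_subset[of B G] unfolding is_graph_def by auto
    ultimately show False by simp
  qed
  then show ?thesis using that B by auto
qed

lemma rank_mono:
  assumes "is_graph G" "H \<subseteq> G"
  shows "r H \<le> r G"
proof -
  obtain B where "B \<subseteq> H" "ind B" "card B = r H" using ex_basis is_graph_subset[OF assms] by blast
  then show ?thesis using card_le_rank[OF assms(1), of B] assms(2) by auto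
qed

lemma rank_le_card:
  assumes "is_graph G"
  shows "r G \<le> card G"
proof -
  obtain B where "B \<subseteq> G" "card B = r G" using ex_basis[OF assms] by blast
  then show ?thesis using assms card_mono[of G B] unfolding is_graph_def by auto
qed

lemma rank_submodular:
  assumes A: "is_graph A" and B: "is_graph B"
  shows "r (A \<union> B) + r (A \<inter> B) \<le> r A + r B"
proof -
  have AB: "is_graph (A \<union> B)" and AiB: "is_graph (A \<inter> B)"
    using assms is_graph_Un is_graph_subset by auto
  obtain I where I: "I \<subseteq> A \<inter> B" "ind I" "card I = r (A \<inter> B)" using ex_basis[OF AiB] .
  obtain K where K: "I \<subseteq> K" "K \<subseteq> A \<union> B" "ind K" "card K = r (A \<union> B)"
    using extend_to_basis[OF AB, of I] I by auto
  have gK: "is_graph K" using K AB is_graph_subset by blast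
  have "ind (K \<inter> A)" "ind (K \<inter> B)" using ind_subset[OF gK \<open>ind K\<close>] by auto
  then have "card (K \<inter> A) \<le> r A" "card (K \<inter> B) \<le> r B"
    using card_le_rank[OF A, of "K \<inter> A"] card_le_rank[OF B, of "K \<inter> B"] by auto
  moreover have "finite K" using gK unfolding is_graph_def by auto
  then have "card (K \<inter> A) + card (K \<inter> B) = card (K \<inter> A \<union> K \<inter> B) + card (K \<inter> A \<inter> (K \<inter> B))"
    by (intro card_Un_Int) auto
  moreover have "card (K \<inter> A \<union> K \<inter> B) = card K" using K by (intro arg_cong[where f=card]) auto
  moreover have "card I \<le> card (K \<inter> A \<inter> (K \<inter> B))"
    using I K \<open>finite K\<close> by (intro card_mono) auto
  ultimately show ?thesis using I K by linarith
qed

lemma rank_Un_le: "is_graph A \<Longrightarrow> is_graph B \<Longrightarrow> r (A \<union> B) \<le> r A + r B"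
  using rank_submodular[of A B] by linarith

lemma rank_submodular_subset:
  assumes "is_graph A" "is_graph B" "C \<subseteq> A" "C \<subseteq> B"
  shows "r (A \<union> B) + r C \<le> r A + r B"
proof -
  have "r C \<le> r (A \<inter> B)" using assms by (intro rank_mono is_graph_subset[OF assms(1)]) auto
  then show ?thesis using rank_submodular[OF assms(1,2)] by linarith
qed

lemma rank_closure:
  assumes "is_graph (A \<union> B)" and eq: "\<And>e. e \<in> B \<Longrightarrow> r (insert e A) = r A"
  shows "r (A \<union> B) = r A"
proof -
  have "finite B" using assms(1) unfolding is_graph_def by auto
  then show ?thesis using assms
  proof (induction B rule: finite_induct)
    case (insert e B)
    have g: "is_graph (A \<union> B)" "is_graph (insert e A)"
      by (rule is_graph_subset[OF insert.prems(1)], blast)+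
    have "r ((A \<union> B) \<union> insert e A) + r A \<le> r (A \<union> B) + r (insert e A)"
      by (rule rank_submodular_subset[OF g]) blast+
    moreover have "r (insert e A) = r A" by (rule insert.prems(2)) simp
    moreover have "r (A \<union> B) = r A" by (rule insert.IH[OF g(1)], rule insert.prems(2)) simp
    moreover have "r ((A \<union> B) \<union> insert e A) = r (A \<union> insert e B)" by (rule arg_cong[where f=r]) auto
    moreover have "r A \<le> r (A \<union> insert e B)" by (rule rank_mono[OF insert.prems(1)]) blast
    ultimately show ?case by linarith
  qed simp
qed

lemma rank_matroid_iso:
  assumes "is_graph G" "is_graph H" "matroid_iso \<psi> G (M G) H (M H)" "X \<subseteq> G"
  shows "r (\<psi> ` X) = r X"
proof -
  have bij: "bij_betw \<psi> G H" using assms unfolding matroid_iso_def by auto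
  have ind: "ind Y \<longleftrightarrow> ind (\<psi> ` Y)" if "Y \<subseteq> G" for Y
  proof -
    have "\<psi> ` Y \<subseteq> H" using that bij unfolding bij_betw_def by auto
    then show ?thesis
      using assms(3) that M_iff_ind[OF assms(1)] M_iff_ind[OF assms(2)] unfolding matroid_iso_def by simp
  qed
  have inj: "inj_on \<psi> G" using bij unfolding bij_betw_def by auto
  have "\<psi> ` X \<subseteq> H" using assms(4) bij unfolding bij_betw_def by auto
  then have gX: "is_graph X" "is_graph (\<psi> ` X)"
    using is_graph_subset[OF assms(1,4)] is_graph_subset[OF assms(2)] by auto
  have "card ` {Y. Y \<subseteq> \<psi> ` X \<and> ind Y} = card ` {Y. Y \<subseteq> X \<and> ind Y}" (is "?L = ?R")
  proof (intro equalityI subsetI)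
    fix k assume "k \<in> ?L"
    then obtain Y where Y: "Y \<subseteq> \<psi> ` X" "ind Y" "k = card Y" by auto
    then obtain Z where "Z \<subseteq> X" "Y = \<psi> ` Z" by (meson subset_imageE)
    moreover from this have "card Y = card Z" using inj assms(4) by (meson card_image inj_on_subset subset_trans)
    ultimately show "k \<in> ?R" using Y ind assms(4) by auto
  next
    fix k assume "k \<in> ?R"
    then obtain Y where Y: "Y \<subseteq> X" "ind Y" "k = card Y" by auto
    moreover from this have "card (\<psi> ` Y) = card Y" using inj assms(4) by (meson card_image inj_on_subset subset_trans)
    moreover have "ind (\<psi> ` Y)" using Y ind assms(4) by auto
    ultimately show "k \<in> ?L" by (metis (mono_tags, lifting) image_mono image_eqI mem_Collect_eq)
  qed
  then show ?thesis using rank_eq gX by simp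
qed

lemma rank_image:
  assumes "is_graph G" "inj_on f (verts G)"
  shows "r ((\<lambda>e. f ` e) ` G) = r G"
proof -
  let ?H = "(\<lambda>e. f ` e) ` G"
  have "card (f ` e) = 2" if "e \<in> G" for e
  proof -
    have "inj_on f e" using assms(2) that unfolding verts_def by (meson Union_upper inj_on_subset)
    then show ?thesis using assms(1) that unfolding is_graph_def by (simp add: card_image)
  qed
  then have H: "is_graph ?H" using assms(1) unfolding is_graph_def by auto
  moreover have "graph_iso f G ?H"
    using assms(2) unfolding graph_iso_def bij_betw_def verts_def by auto
  ultimately have "matroid_iso (\<lambda>e. f ` e) G (M G) ?H (M ?H)"
    using family assms(1) unfolding graph_matroid_family_def by blast
  then show ?thesis using rank_matroid_iso[OF assms(1) H] by blast
qed

definition kr :: "nat \<Rightarrow> nat" where "kr n = r (complete_graph {0..<n})"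

lemma rank_complete: "finite V \<Longrightarrow> r (complete_graph V) = kr (card V)"
proof -
  assume V: "finite V"
  then obtain f where f: "bij_betw f {0..<card V} V" using ex_bij_betw_nat_finite by blast
  then have inj: "inj_on f {0..<card V}" and im: "f ` {0..<card V} = V" unfolding bij_betw_def by auto
  have "r ((\<lambda>e. f ` e) ` complete_graph {0..<card V}) = kr (card V)"
    unfolding kr_def by (intro rank_image is_graph_complete inj_on_subset[OF inj] verts_complete_subset) simp
  then show ?thesis using image_complete[OF inj] im by simp
qed

lemma kr_mono: "m \<le> n \<Longrightarrow> kr m \<le> kr n"
  unfolding kr_def by (intro rank_mono is_graph_complete complete_graph_mono) auto

lemma rank_le_kr:
  assumes "is_graph G" "verts G \<subseteq> V" "finite V"
  shows "r G \<le> kr (card V)"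
  using rank_mono[OF is_graph_complete[OF assms(3)] subset_complete[OF assms(1,2)]]
    rank_complete[OF assms(3)] by simp

lemma rigid_iff: "is_graph G \<Longrightarrow> rigid M G \<longleftrightarrow> r G = kr (card (verts G))"
  unfolding rigid_def using rank_complete finite_verts by simp


subsection \<open>From the Whitney property to the Lovasz-Yemini property\<close>

text \<open>The edge \<open>f\<close> lies outside the closure of \<open>G\<close>: a basis of
  \<open>G\<close> through \<open>Y\<close> is augmented from a basis of \<open>insert f G\<close>,
  and the new element must be \<open>f\<close>, since one from \<open>G\<close> would exceed
  \<open>r G\<close>.\<close>

lemma ind_insert:
  assumes G: "is_graph G" and "card f = 2" "r G < r (insert f G)" "Y \<subseteq> G" "ind Y"
  shows "ind (insert f Y)"
proof -
  have Gf: "is_graph (insert f G)" using is_graph_insert assms by blast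
  obtain B where B: "Y \<subseteq> B" "B \<subseteq> G" "ind B" "card B = r G" using extend_to_basis[OF G assms(4,5)] .
  obtain J where J: "J \<subseteq> insert f G" "ind J" "card J = r (insert f G)" using ex_basis[OF Gf] .
  have gB: "is_graph B" and gJ: "is_graph J" using is_graph_subset[OF G B(2)] is_graph_subset[OF Gf J(1)] by auto
  obtain y where y: "y \<in> J - B" "ind (insert y B)"
    using ind_augment[OF gB gJ B(3) J(2)] B J assms(3) by auto
  have "finite B" using gB unfolding is_graph_def by auto
  have "y \<notin> G"
  proof
    assume "y \<in> G"
    then have "card (insert y B) \<le> r G" using y B by (intro card_le_rank[OF G]) auto
    then show False using y B \<open>finite B\<close> by auto
  qed
  then have "y = f" using y J by auto
  moreover have "is_graph (insert y B)" using is_graph_subset[OF Gf, of "insert y B"] B \<open>y = f\<close> by auto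
  ultimately show ?thesis using ind_subset[of "insert y B" "insert f Y"] y B by auto
qed

text \<open>A circuit \<open>C\<close> inside \<open>X\<close> can be placed in a large complete
  graph with a chosen edge \<open>e\<close> landing on \<open>{u, v}\<close>; its other edges then
  span \<open>{u, v}\<close>. The threshold \<open>n0\<close> is the number of vertices of
  \<open>C\<close>.\<close>

lemma complete_minus_edge_spans:
  assumes "is_graph X" "\<not> ind X"
  obtains n0 where
    "\<And>V u v. finite V \<Longrightarrow> n0 \<le> card V \<Longrightarrow> u \<in> V \<Longrightarrow> v \<in> V \<Longrightarrow> u \<noteq> v \<Longrightarrow>
      r (complete_graph V - {{u, v}}) = r (complete_graph V)"
proof -
  \<comment> \<open>A dependent set of least size becomes independent when any edge is removed,
    hence is a circuit.\<close>
  define C where "C = (ARG_MIN card C. C \<subseteq> X \<and> \<not> ind C)"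
  have C: "C \<subseteq> X \<and> \<not> ind C"
    unfolding C_def by (rule arg_min_natI[of _ X]) (use assms in auto)
  have Cmin: "card C \<le> card D" if "D \<subseteq> X" "\<not> ind D" for D
    unfolding C_def by (rule arg_min_nat_le) (use that in auto)
  have gC: "is_graph C" using C is_graph_subset[OF assms(1)] by blast
  then have finC: "finite C" unfolding is_graph_def by auto
  have "C \<noteq> {}" using C ind_empty by auto
  then obtain e where e: "e \<in> C" by auto
  then obtain a b where ab: "e = {a, b}" "a \<noteq> b" using is_graph_edgeE[OF gC] by metis
  have "card (C - {e}) < card C" using finC e by (rule card_Diff1_less)
  then have indCe: "ind (C - {e})" using Cmin[of "C - {e}"] C by auto
  \<comment> \<open>A basis of the dependent set \<open>C\<close> is a proper subset, so it is no
    larger than the independent set \<open>C - {e}\<close>.\<close>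
  have rC: "r C \<le> r (C - {e})"
  proof -
    obtain B where B: "B \<subseteq> C" "ind B" "card B = r C" using ex_basis[OF gC] .
    then have "card B < card C" using C finC by (metis psubsetI psubset_card_mono)
    moreover have "card (C - {e}) \<le> r (C - {e})"
      using indCe is_graph_subset[OF gC] by (intro card_le_rank) auto
    ultimately show ?thesis using B finC e by auto
  qed
  have "r (complete_graph V - {{u, v}}) = r (complete_graph V)"
    if V: "finite V" "card (verts C) \<le> card V" "u \<in> V" "v \<in> V" "u \<noteq> v" for V u v
  proof -
    have abC: "{a, b} \<subseteq> verts C" using e ab unfolding verts_def by auto
    have "card (verts C - {a, b}) \<le> card (V - {u, v})"
      using V ab abC finite_verts[OF gC] by (simp add: card_Diff_subset)
    then obtain g where g: "g ` (verts C - {a, b}) \<subseteq> V - {u, v}" "inj_on g (verts C - {a, b})"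
      using V finite_verts[OF gC] card_le_inj[of "verts C - {a, b}" "V - {u, v}"] by auto
    \<comment> \<open>An injection of \<open>verts C\<close> into \<open>V\<close> carrying
      \<open>e\<close> to \<open>{u, v}\<close>.\<close>
    define f where "f = g(a := u, b := v)"
    have fV: "f ` verts C \<subseteq> V" using g V unfolding f_def by auto
    have finj: "inj_on f (verts C)"
    proof -
      have "inj_on f (verts C - {a, b})"
        using g(2) by (rule inj_on_cong[THEN iffD1, rotated]) (auto simp: f_def)
      moreover have "f ` (verts C - {a, b}) \<subseteq> V - {u, v}" using g(1) unfolding f_def by auto
      moreover have "f a = u" "f b = v" using ab(2) unfolding f_def by auto
      ultimately have "inj_on f (insert a (insert b (verts C - {a, b})))"
        using V(5) unfolding inj_on_insert by blast
      moreover have "insert a (insert b (verts C - {a, b})) = verts C" using abC by auto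
      ultimately show ?thesis by simp
    qed
    let ?C = "(\<lambda>e. f ` e) ` C" and ?D = "(\<lambda>e. f ` e) ` (C - {e})"
    let ?K = "complete_graph V"
    have fe: "f ` e = {u, v}" using ab unfolding f_def by auto
    have K: "is_graph ?K" using V is_graph_complete by auto
    have "?C \<subseteq> complete_graph (f ` verts C)"
      using image_mono[OF subset_complete[OF gC subset_refl], of "(`) f"] image_complete[OF finj] by simp
    then have CK: "?C \<subseteq> ?K" using complete_graph_mono[OF fV] by auto
    have DK: "?D \<subseteq> ?K - {{u, v}}"
    proof
      fix x assume "x \<in> ?D"
      then obtain e' where e': "e' \<in> C" "e' \<noteq> e" "x = f ` e'" by auto
      have "f ` e' \<noteq> f ` e"
        using e' e finj unfolding verts_def by (metis Union_upper inj_on_image_eq_iff)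
      then show "x \<in> ?K - {{u, v}}" using CK e' fe by auto
    qed
    have "r ?C = r C" by (rule rank_image[OF gC finj])
    moreover have "r ?D = r (C - {e})"
      by (rule rank_image) (use is_graph_subset[OF gC] inj_on_subset[OF finj] verts_mono[of "C - {e}" C] in auto)
    \<comment> \<open>The two graphs unite to \<open>?K\<close> and share \<open>?D\<close>, which
      by \<open>rC\<close> has the rank of \<open>?C\<close>; so the missing edge adds
      nothing.\<close>
    moreover have "r ((?K - {{u, v}}) \<union> ?C) + r ?D \<le> r (?K - {{u, v}}) + r ?C"
      using is_graph_subset[OF K] CK DK by (intro rank_submodular_subset) auto
    moreover have "{u, v} \<in> ?C" using e fe by (metis imageI)
    then have "(?K - {{u, v}}) \<union> ?C = ?K" using CK by blast
    moreover have "r (?K - {{u, v}}) \<le> r ?K" by (rule rank_mono[OF K]) auto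
    ultimately show ?thesis using rC by simp
  qed
  then show ?thesis using that by blast
qed

text \<open>If all graphs were independent, every permutation of the edges of a complete graph would
  be a matroid automorphism; a swap of two edges is induced by no vertex map once there are four
  vertices.\<close>

lemma whitney_imp_dependent:
  assumes "whitney_property M"
  obtains X where "is_graph X" "\<not> ind X"
proof (rule ccontr)
  assume "\<not> thesis"
  then have all: "ind X" if "is_graph X" for X using that \<open>\<And>X. \<lbrakk>is_graph X; \<not> ind X\<rbrakk> \<Longrightarrow> thesis\<close> by blast
  obtain c where c: "\<And>G. is_graph G \<Longrightarrow> k_connected c G \<Longrightarrow> reconstructible M G"
    using assms unfolding whitney_property_def by blast
  \<comment> \<open>At least \<open>c + 1\<close> vertices for connectivity, and at least four to
    have \<open>0\<close> to \<open>3\<close> available.\<close>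
  define V where "V = {0..<c + 4}"
  define K where "K = complete_graph V"
  have V: "0 \<in> V" "1 \<in> V" "2 \<in> V" "3 \<in> V" unfolding V_def by auto
  have edge: "{u, v} \<in> K" if "u \<in> V" "v \<in> V" "u \<noteq> v" for u v
    using that unfolding K_def complete_graph_def by auto
  have gK: "is_graph K" unfolding K_def V_def by (simp add: is_graph_complete)
  have vK: "verts K = V"
  proof
    show "verts K \<subseteq> V" unfolding K_def by (rule verts_complete_subset)
    show "V \<subseteq> verts K"
    proof
      fix v assume v: "v \<in> V"
      have "\<exists>u\<in>V. u \<noteq> v" using V by (metis zero_neq_one)
      then show "v \<in> verts K" using edge v unfolding verts_def by blast
    qed
  qed
  have "connected_on W K" if "W \<subseteq> V" for W
    unfolding connected_on_def
  proof (intro ballI)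
    fix u v assume "u \<in> W" "v \<in> W"
    then show "(u, v) \<in> {(x, y). x \<in> W \<and> y \<in> W \<and> {x, y} \<in> K}\<^sup>*"
      using edge[of u v] that by (cases "u = v") auto
  qed
  then have "k_connected c K" unfolding k_connected_def vK by (auto simp: V_def)
  then have rec: "reconstructible M K" using c gK by blast
  define e1 e2 where "e1 = {0, 1 :: nat}" and "e2 = {0, 2 :: nat}"
  have e: "e1 \<in> K" "e2 \<in> K" "e1 \<noteq> e2" unfolding e1_def e2_def using edge V by (auto simp: doubleton_eq_iff)
  define \<psi> where "\<psi> = id(e1 := e2, e2 := e1)"
  have "bij_betw \<psi> K K"
    using e by (intro bij_betw_byWitness[of _ \<psi>]) (auto simp: \<psi>_def)
  moreover have "M K X \<longleftrightarrow> M K (\<psi> ` X)" if "X \<subseteq> K" for X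
  proof -
    have "\<psi> ` X \<subseteq> K" using that e unfolding \<psi>_def by auto
    then show ?thesis
      using that all[OF is_graph_subset[OF gK that]] all[OF is_graph_subset[OF gK, of "\<psi> ` X"]] M_iff_ind[OF gK] by simp
  qed
  ultimately have "matroid_iso \<psi> K (M K) K (M K)" unfolding matroid_iso_def by blast
  then obtain \<phi> where \<phi>: "\<forall>u v. {u, v} \<in> K \<longrightarrow> \<psi> {u, v} = {\<phi> u, \<phi> v}"
    using rec gK unfolding reconstructible_def by blast
  \<comment> \<open>The edges from \<open>3\<close> to \<open>0\<close> and to \<open>1\<close> are
    not swapped and meet only in \<open>3\<close>, so \<open>\<phi>\<close> fixes \<open>3\<close>,
    \<open>0\<close> and \<open>1\<close>; but then \<open>e1\<close> would be fixed too.\<close>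
  have fix3: "{\<phi> u, \<phi> 3} = {u, 3}" if "u = 0 \<or> u = 1" for u
  proof -
    have "{u, 3} \<in> K" "{u, 3} \<noteq> e1" "{u, 3} \<noteq> e2"
      using that edge V unfolding e1_def e2_def by (auto simp: doubleton_eq_iff)
    moreover from this have "\<psi> {u, 3} = {u, 3}" unfolding \<psi>_def by (simp only: fun_upd_apply id_apply if_False)
    ultimately show ?thesis using \<phi> by metis
  qed
  have "\<phi> 0 = 0" "\<phi> 1 = 1" using fix3[of 0] fix3[of 1] by (auto simp: doubleton_eq_iff)
  moreover have "\<psi> e1 = {\<phi> 0, \<phi> 1}" using \<phi> e unfolding e1_def by auto
  moreover have "\<psi> e1 = e2" using e(3) unfolding \<psi>_def by auto
  ultimately show False using e(3) unfolding e1_def by simp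
qed

text \<open>A complete graph minus one edge is highly connected, hence rigid, so the complete graph
  has an edge to spare.\<close>

lemma lovasz_yemini_imp_dependent:
  assumes "lovasz_yemini_property M"
  obtains X where "is_graph X" "\<not> ind X"
proof -
  obtain c where c: "\<And>G. is_graph G \<Longrightarrow> k_connected c G \<Longrightarrow> rigid M G"
    using assms unfolding lovasz_yemini_property_def by blast
  define V where "V = {0..<c + 3}"
  define K where "K = complete_graph V - {{0, 1}}"
  have KV: "is_graph (complete_graph V)" unfolding V_def by (simp add: is_graph_complete)
  then have gK: "is_graph K" unfolding K_def by (rule is_graph_subset) auto
  have V: "0 \<in> V" "1 \<in> V" "2 \<in> V" unfolding V_def by auto
  have edge: "{u, v} \<in> K" if "u \<in> V" "v \<in> V" "u \<noteq> v" "2 \<le> u" for u v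
    using that unfolding K_def complete_graph_def by (auto simp: doubleton_eq_iff)
  have vK: "verts K = V"
  proof
    show "verts K \<subseteq> V" using verts_mono[of K "complete_graph V"] verts_complete_subset unfolding K_def by blast
    show "V \<subseteq> verts K"
    proof
      fix v assume v: "v \<in> V"
      have "\<exists>e\<in>K. v \<in> e"
      proof (cases "2 \<le> v")
        case True
        then show ?thesis using edge[of v 0] v V by auto
      next
        case False
        then show ?thesis using edge[of 2 v] v V by auto
      qed
      then show "v \<in> verts K" unfolding verts_def by blast
    qed
  qed
  have "connected_on (V - X) K" if "X \<subseteq> V" "card X < c" for X
  proof -
    have fX: "finite X" using that(1) finite_subset unfolding V_def by blast
    \<comment> \<open>Of the \<open>c + 3\<close> vertices, some \<open>z\<close> other than
      \<open>0\<close> and \<open>1\<close> survives the deletion of \<open>X\<close>; it is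
      adjacent to every other survivor.\<close>
    have "card (X \<union> {0, 1}) < card V"
      using that card_Un_le[of X "{0, 1}"] unfolding V_def by simp
    then obtain z where z: "z \<in> V" "z \<notin> X \<union> {0, 1}"
      using ex_mem_not_in[of "X \<union> {0, 1}" V] fX by auto
    let ?R = "{(x, y). x \<in> V - X \<and> y \<in> V - X \<and> {x, y} \<in> K}"
    have zz: "(z, u) \<in> ?R\<^sup>* \<and> (u, z) \<in> ?R\<^sup>*" if "u \<in> V - X" for u
    proof (cases "u = z")
      case False
      then have "{z, u} \<in> K" using z that by (intro edge) auto
      then have "(z, u) \<in> ?R" "(u, z) \<in> ?R" using z that by (auto simp: insert_commute)
      then show ?thesis by blast
    qed simp
    show ?thesis unfolding connected_on_def using zz by (meson rtrancl_trans)
  qed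
  then have "k_connected c K" unfolding k_connected_def vK by (auto simp: V_def)
  then have "r K = r (complete_graph V)" using c gK vK unfolding rigid_def by auto
  moreover have "r K \<le> card K" using gK by (rule rank_le_card)
  moreover have "{0, 1} \<in> complete_graph V" using V unfolding complete_graph_def by force
  then have "card K < card (complete_graph V)"
    using KV unfolding K_def is_graph_def by (intro card_Diff1_less) auto
  ultimately have "\<not> ind (complete_graph V)" using card_le_rank[OF KV, of "complete_graph V"] by auto
  then show ?thesis using that KV by blast
qed

lemma whitney_imp_lovasz_yemini:
  assumes "whitney_property M"
  shows "lovasz_yemini_property M"
proof -
  obtain X where "is_graph X" "\<not> ind X" using whitney_imp_dependent[OF assms] .
  then obtain n0 where spans: "\<And>V u v. finite V \<Longrightarrow> n0 \<le> card V \<Longrightarrow> u \<in> V \<Longrightarrow> v \<in> V \<Longrightarrow> u \<noteq> v \<Longrightarrow>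
      r (complete_graph V - {{u, v}}) = r (complete_graph V)"
    using complete_minus_edge_spans by blast
  obtain c where c: "\<And>G. is_graph G \<Longrightarrow> k_connected c G \<Longrightarrow> reconstructible M G"
    using assms unfolding whitney_property_def by blast
  \<comment> \<open>The summand \<open>c\<close> yields reconstructibility, \<open>n0\<close> enough
    vertices to apply \<open>spans\<close>, and \<open>2\<close> two edges at every vertex.\<close>
  have "rigid M G" if G: "is_graph G" and con: "k_connected (c + n0 + 2) G" for G
  proof (rule ccontr)
    assume nr: "\<not> rigid M G"
    let ?V = "verts G" and ?K = "complete_graph (verts G)"
    have fV: "finite ?V" using finite_verts[OF G] .
    have K: "is_graph ?K" and GK: "G \<subseteq> ?K" using is_graph_complete[OF fV] subset_complete[OF G] by auto
    have V: "n0 \<le> card ?V" using con unfolding k_connected_def by auto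
    have less: "r G < r ?K" using nr rank_mono[OF K GK] unfolding rigid_def by auto
    \<comment> \<open>The pairs of vertices outside the closure of \<open>G\<close>. There are at
      least two: were all but \<open>f\<close> in the closure, \<open>G\<close> would span
      \<open>?K - {f}\<close> and hence \<open>?K\<close>.\<close>
    define F where "F = {e \<in> ?K. r (insert e G) \<noteq> r G}"
    have nF: "\<not> F \<subseteq> {f}" if f: "f \<in> ?K" for f
    proof
      assume F: "F \<subseteq> {f}"
      obtain u v where uv: "f = {u, v}" "u \<in> ?V" "v \<in> ?V" "u \<noteq> v" using f unfolding complete_graph_def by blast
      have "r (G \<union> (?K - {f})) = r G"
        by (rule rank_closure) (use F is_graph_subset[OF K] GK in \<open>auto simp: F_def\<close>)
      moreover have "r (?K - {f}) \<le> r (G \<union> (?K - {f}))"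
        by (rule rank_mono) (use is_graph_subset[OF K] GK in auto)
      moreover have "r (?K - {f}) = r ?K" using spans[OF fV V uv(2-4)] uv by simp
      ultimately show False using less by simp
    qed
    have "G \<noteq> {}" using con unfolding k_connected_def verts_def by auto
    then obtain f where f: "f \<in> F" using nF GK by blast
    then obtain f' where f': "f' \<in> F" "f' \<noteq> f" using nF[of f] unfolding F_def by blast
    have F_props: "g \<notin> G \<and> card g = 2 \<and> r G < r (insert g G) \<and> is_graph (insert g G) \<and> verts (insert g G) = verts G"
      if "g \<in> F" for g
    proof -
      have g: "g \<in> ?K" "r (insert g G) \<noteq> r G" using that unfolding F_def by auto
      moreover from g have "g \<notin> G" by (metis insert_absorb)
      moreover have "card g = 2" using g K unfolding is_graph_def by auto
      moreover from this have "is_graph (insert g G)" using is_graph_insert G by blast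
      moreover from this have "r G \<le> r (insert g G)" by (rule rank_mono) auto
      moreover have "g \<subseteq> verts G" using g verts_complete_subset[of ?V] unfolding verts_def by blast
      ultimately show ?thesis unfolding verts_def by auto
    qed
    define \<psi> where "\<psi> = id(f := f')"
    have \<psi>: "\<psi> e = e" if "e \<in> G" for e using that F_props[OF f] unfolding \<psi>_def by auto
    have \<psi>G: "\<psi> ` Y = Y" if "Y \<subseteq> G" for Y
    proof -
      have "\<psi> ` Y = (\<lambda>e. e) ` Y" by (rule image_cong) (use \<psi> that in auto)
      then show ?thesis by simp
    qed
    have \<psi>f: "\<psi> f = f'" unfolding \<psi>_def by simp
    have con2: "k_connected c (insert f G)"
    proof -
      have "k_connected c G" using con k_connected_mono by (metis le_add1 add.assoc)
      then show ?thesis using F_props[OF f] connected_on_mono[of _ G "insert f G"]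
        unfolding k_connected_def by auto
    qed
    have "inj_on \<psi> (insert f G)" using F_props[OF f'(1)] F_props[OF f] \<psi> \<psi>f unfolding inj_on_def by auto
    then have bij: "bij_betw \<psi> (insert f G) (insert f' G)"
      unfolding bij_betw_def using \<psi>G[of G] \<psi>f by auto
    have "M (insert f G) X \<longleftrightarrow> M (insert f' G) (\<psi> ` X)" if X: "X \<subseteq> insert f G" for X
    proof -
      have "ind X \<longleftrightarrow> ind (\<psi> ` X)"
      proof (cases "f \<in> X")
        case False
        then have "X \<subseteq> G" using X by auto
        then show ?thesis using \<psi>G by simp
      next
        case True
        define Y where "Y = X - {f}"
        have Y: "Y \<subseteq> G" "X = insert f Y" using X True unfolding Y_def by auto
        \<comment> \<open>Each edge of \<open>F\<close> is a coloop over \<open>G\<close>, so adding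
          it to \<open>Y\<close> does not affect independence; this serves both \<open>f\<close> and
          \<open>f'\<close>.\<close>
        have "ind (insert g Y) \<longleftrightarrow> ind Y" if "g \<in> F" for g
        proof
          assume "ind Y"
          then show "ind (insert g Y)" using ind_insert[OF G] F_props[OF that] Y(1) by blast
        next
          assume "ind (insert g Y)"
          moreover have "is_graph (insert g Y)"
            using is_graph_insert is_graph_subset[OF G Y(1)] F_props[OF that] by blast
          ultimately show "ind Y" using ind_subset by blast
        qed
        then show ?thesis using f f' Y \<psi>f \<psi>G by simp
      qed
      moreover have "\<psi> ` X \<subseteq> insert f' G" using image_mono[OF X, of \<psi>] bij_betw_imp_surj_on[OF bij] by simp
      ultimately show ?thesis using M_iff_ind F_props[OF f] F_props[OF f'(1)] X by simp
    qed
    then have iso: "matroid_iso \<psi> (insert f G) (M (insert f G)) (insert f' G) (M (insert f' G))"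
      using bij unfolding matroid_iso_def by simp
    have "reconstructible M (insert f G)" using c con2 F_props[OF f] by simp
    then have "\<exists>\<phi>. graph_iso \<phi> (insert f G) (insert f' G) \<and>
        (\<forall>u v. {u, v} \<in> insert f G \<longrightarrow> \<psi> {u, v} = {\<phi> u, \<phi> v})"
      unfolding reconstructible_def using iso F_props[OF f'(1)] by (elim allE) (erule mp, simp)
    then obtain \<phi> where \<phi>: "\<And>u v. {u, v} \<in> insert f G \<Longrightarrow> \<psi> {u, v} = {\<phi> u, \<phi> v}"
      by (elim exE conjE) simp
    \<comment> \<open>Two fixed edges at \<open>v\<close> meet only in \<open>v\<close>, which
      \<open>\<phi>\<close> must therefore fix.\<close>
    have fixed: "\<phi> v = v" if v: "v \<in> verts G" for v
    proof -
      have "2 \<le> card (nbhd G v)" using k_connected_card_nbhd[OF G con v] by simp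
      then obtain x y where "x \<in> nbhd G v" "y \<in> nbhd G v" "x \<noteq> y"
        using two_distinct by blast
      then have G: "{v, x} \<in> G" "{v, y} \<in> G" "x \<noteq> y" unfolding nbhd_def by auto
      then have "{v, x} = {\<phi> v, \<phi> x}" "{v, y} = {\<phi> v, \<phi> y}"
        using \<phi>[of v x] \<phi>[of v y] \<psi>[OF G(1)] \<psi>[OF G(2)] by simp_all
      then show ?thesis using G(3) by (metis doubleton_eq_iff)
    qed
    obtain u v where "f = {u, v}" "u \<in> verts G" "v \<in> verts G" using f unfolding F_def complete_graph_def by blast
    then have "\<psi> f = f" using \<phi>[of u v] fixed by simp
    then show False using \<psi>f f' by simp
  qed
  then show ?thesis unfolding lovasz_yemini_property_def by blast
qed

subsection \<open>From the Lovasz-Yemini property to the Whitney property\<close>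

text \<open>Two complete graphs on \<open>n + 1\<close> vertices sharing \<open>n\<close> of them
  make up a complete graph on \<open>n + 2\<close> vertices minus one edge, which has full rank.
  Submodularity then makes the increments of \<open>kr\<close> nonincreasing from \<open>n0\<close>
  on, so they settle at a constant, which unboundedness keeps positive.\<close>

lemma eventually_linear:
  assumes "lovasz_yemini_property M" "unbounded M"
  obtains N d where "\<And>n. N \<le> n \<Longrightarrow> kr (Suc n) = kr n + d" "1 \<le> d"
proof -
  obtain X where "is_graph X" "\<not> ind X" using lovasz_yemini_imp_dependent[OF assms(1)] .
  then obtain n0 where spans: "\<And>V u v. finite V \<Longrightarrow> n0 \<le> card V \<Longrightarrow> u \<in> V \<Longrightarrow> v \<in> V \<Longrightarrow> u \<noteq> v \<Longrightarrow>
      r (complete_graph V - {{u, v}}) = r (complete_graph V)"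
    using complete_minus_edge_spans by blast
  define \<delta> where "\<delta> n = kr (Suc n) - kr n" for n
  have \<delta>: "kr (Suc n) = kr n + \<delta> n" for n unfolding \<delta>_def using kr_mono[of n "Suc n"] by simp
  have anti: "\<delta> (Suc n) \<le> \<delta> n" if n: "n0 \<le> n" for n
  proof -
    let ?A = "complete_graph (insert n {0..<n})" and ?B = "complete_graph (insert (Suc n) {0..<n})"
    let ?V = "{0..<Suc (Suc n)}"
    have "r (?A \<union> ?B) + r (complete_graph {0..<n}) \<le> r ?A + r ?B"
      by (rule rank_submodular_subset; (rule is_graph_complete | rule complete_graph_mono)) auto
    moreover have "?A \<union> ?B = complete_graph ?V - {{n, Suc n}}"
    proof (intro equalityI subsetI)
      fix e assume "e \<in> complete_graph ?V - {{n, Suc n}}"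
      then obtain x y where xy: "e = {x, y}" "x < Suc (Suc n)" "y < Suc (Suc n)" "x \<noteq> y" "{x, y} \<noteq> {n, Suc n}"
        unfolding complete_graph_def by auto
      then have "x \<noteq> Suc n \<and> y \<noteq> Suc n \<or> x \<noteq> n \<and> y \<noteq> n" by auto
      then have "{x, y} \<subseteq> insert n {0..<n} \<or> {x, y} \<subseteq> insert (Suc n) {0..<n}" using xy(2,3) by auto
      then show "e \<in> ?A \<union> ?B" unfolding complete_graph_def using xy(1,4) by blast
    next
      fix e assume e: "e \<in> ?A \<union> ?B"
      have "?A \<union> ?B \<subseteq> complete_graph ?V" by (intro Un_least complete_graph_mono) auto
      moreover have "e \<subseteq> insert n {0..<n} \<or> e \<subseteq> insert (Suc n) {0..<n}"
        using e unfolding complete_graph_def by blast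
      then have "e \<noteq> {n, Suc n}" by auto
      ultimately show "e \<in> complete_graph ?V - {{n, Suc n}}" using e by blast
    qed
    moreover have "r (complete_graph ?V - {{n, Suc n}}) = r (complete_graph ?V)"
      using n by (intro spans) auto
    moreover have "r (complete_graph ?V) = kr (Suc (Suc n))" "r (complete_graph {0..<n}) = kr n"
      "r ?A = kr (Suc n)" "r ?B = kr (Suc n)"
      by (simp_all add: rank_complete)
    ultimately have "kr (Suc (Suc n)) + kr n \<le> kr (Suc n) + kr (Suc n)" by simp
    then show ?thesis using \<delta>[of n] \<delta>[of "Suc n"] by simp
  qed
  \<comment> \<open>A nonincreasing sequence of naturals is constant from a place where it attains
    its minimum.\<close>
  define N where "N = (ARG_MIN \<delta> n. n0 \<le> n)"
  have N: "n0 \<le> N" unfolding N_def by (rule arg_min_natI[of _ n0]) simp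
  have min: "\<delta> N \<le> \<delta> n" if "n0 \<le> n" for n unfolding N_def by (rule arg_min_nat_le) (rule that)
  have const: "\<delta> n = \<delta> N" if "N \<le> n" for n
    using that
  proof (induction n rule: dec_induct)
    case (step n)
    then show ?case using anti[of n] min[of "Suc n"] N by simp
  qed simp
  have "\<delta> N \<noteq> 0"
  proof
    assume 0: "\<delta> N = 0"
    have eq: "kr n = kr N" if "N \<le> n" for n
      using that
    proof (induction n rule: dec_induct)
      case (step n)
      then show ?case using \<delta>[of n] const[of n] 0 by simp
    qed simp
    have bound: "kr n \<le> kr N" for n
    proof (cases "N \<le> n")
      case True
      then show ?thesis using eq[of n] by simp
    next
      case False
      then show ?thesis using kr_mono[of n N] by simp
    qed
    obtain n where "kr N < kr n" using assms(2) unfolding unbounded_def kr_def by blast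
    then show False using bound[of n] by simp
  qed
  moreover have "kr (Suc n) = kr n + \<delta> N" if "N \<le> n" for n using \<delta>[of n] const[OF that] by linarith
  ultimately show ?thesis by (intro that[of N "\<delta> N"]) simp_all
qed

text \<open>A permutation of \<open>V\<close> that maps \<open>S\<close> onto \<open>T\<close> and
  fixes \<open>w\<close> preserves the complete graph on \<open>V\<close>.\<close>

lemma rank_star_symmetric:
  assumes "finite V" "w \<notin> V" "S \<subseteq> V" "T \<subseteq> V" "card S = card T"
  shows "r (complete_graph V \<union> star w S) = r (complete_graph V \<union> star w T)"
proof -
  have fin: "finite S" "finite T" using assms finite_subset by auto
  obtain g where g: "bij_betw g S T" using finite_same_card_bij[OF fin assms(5)] by blast
  have "card (V - S) = card (V - T)" using assms fin by (simp add: card_Diff_subset)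
  then obtain h where h: "bij_betw h (V - S) (V - T)" using finite_same_card_bij assms(1) by (metis finite_Diff)
  define f where "f x = (if x \<in> S then g x else if x \<in> V then h x else x)" for x
  have fS: "bij_betw f S T" using g by (rule bij_betw_cong[THEN iffD1, rotated]) (auto simp: f_def)
  have fVS: "bij_betw f (V - S) (V - T)" using h by (rule bij_betw_cong[THEN iffD1, rotated]) (auto simp: f_def)
  have fw: "f w = w" using assms unfolding f_def by auto
  have "bij_betw f (S \<union> (V - S)) (T \<union> (V - T))" using fS fVS by (rule bij_betw_combine) auto
  moreover have "S \<union> (V - S) = V" "T \<union> (V - T) = V" using assms by auto
  ultimately have fV: "bij_betw f V V" by simp
  have "inj_on f (insert w V)" using fV fw assms(2) unfolding bij_betw_def by auto
  moreover have gr: "is_graph (complete_graph V \<union> star w S)"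
    using assms fin by (intro is_graph_Un is_graph_complete is_graph_star) auto
  moreover have "verts (complete_graph V \<union> star w S) \<subseteq> insert w V"
    using assms(3) unfolding verts_def complete_graph_def star_def by auto
  ultimately have "r ((\<lambda>e. f ` e) ` (complete_graph V \<union> star w S)) = r (complete_graph V \<union> star w S)"
    by (intro rank_image) (auto intro: inj_on_subset)
  moreover have "(\<lambda>e. f ` e) ` complete_graph V = complete_graph V"
    using image_complete[of f V] fV unfolding bij_betw_def by simp
  moreover have "(\<lambda>e. f ` e) ` star w S = star (f w) (f ` S)" unfolding star_def by (simp add: image_image)
  moreover have "f ` S = T" using fS unfolding bij_betw_def by simp
  ultimately show ?thesis using fw by (simp add: image_Un)
qed

text \<open>The edges at \<open>w\<close> are added one at a time. By symmetry, when one new edge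
  fails to raise the rank, no edge from \<open>w\<close> to \<open>V\<close> does, so the rank is
  already that of the complete graph on \<open>insert w V\<close> and the gain is at least
  \<open>d\<close>.\<close>

lemma rank_complete_add_star:
  assumes V: "finite V" "w \<notin> V" and d: "kr (card V) + d \<le> kr (Suc (card V))" and "S \<subseteq> V"
  shows "r (complete_graph V) + min d (card S) \<le> r (complete_graph V \<union> star w S)"
proof -
  let ?K = "complete_graph V"
  have "finite S" using assms finite_subset by auto
  then show ?thesis using \<open>S \<subseteq> V\<close>
  proof (induction S rule: finite_induct)
    case empty
    then show ?case by (simp add: star_def)
  next
    case (insert x S)
    let ?L = "?K \<union> star w S"
    have SV: "S \<subseteq> V" "x \<in> V" using insert.prems by auto
    have gr: "is_graph (?K \<union> star w V)" using V by (intro is_graph_Un is_graph_complete is_graph_star)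
    have ins: "?K \<union> star w (insert y S) = insert {w, y} ?L" for y unfolding star_def by auto
    have le: "r ?L \<le> r (?K \<union> star w (insert x S))"
    proof (rule rank_mono)
      show "is_graph (?K \<union> star w (insert x S))"
        using is_graph_subset[OF gr] star_mono[OF insert.prems, of w] by (meson Un_mono subset_refl)
    qed (auto simp: star_def)
    show ?case
    proof (cases "r (?K \<union> star w (insert x S)) = r ?L")
      case False
      then show ?thesis using le insert.IH[OF SV(1)] insert.hyps by simp
    next
      case True
      have "r (insert e ?L) = r ?L" if e: "e \<in> star w V" for e
      proof -
        from e obtain y where y: "e = {w, y}" "y \<in> V" unfolding star_def by (rule imageE)
        show ?thesis
        proof (cases "y \<in> S")
          case True
          then have "e \<in> ?L" using y unfolding star_def by auto
          then show ?thesis by (simp add: insert_absorb)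
        next
          case False
          then have "r (?K \<union> star w (insert y S)) = r (?K \<union> star w (insert x S))"
            using insert.hyps SV y V by (intro rank_star_symmetric) auto
          then show ?thesis using \<open>r (?K \<union> star w (insert x S)) = r ?L\<close> ins y by simp
        qed
      qed
      moreover have "?L \<union> star w V = ?K \<union> star w V" using star_mono[OF SV(1)] by auto
      ultimately have "r (?K \<union> star w V) = r ?L" using rank_closure[of ?L "star w V"] gr by simp
      moreover have "r (?K \<union> star w V) = kr (Suc (card V))"
        using rank_complete[of "insert w V"] V complete_insert[OF V(2)] by simp
      moreover have "r ?K = kr (card V)" using rank_complete V by simp
      ultimately show ?thesis using d True by simp
    qed
  qed
qed

lemma matroid_iso_restrict:
  assumes "is_graph G" "is_graph H" "matroid_iso \<psi> G (M G) H (M H)" "X \<subseteq> G"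
  shows "matroid_iso \<psi> X (M X) (\<psi> ` X) (M (\<psi> ` X))"
proof -
  have bij: "bij_betw \<psi> G H" using assms(3) unfolding matroid_iso_def by simp
  have "\<psi> ` X \<subseteq> H" using image_mono[OF assms(4), of \<psi>] bij_betw_imp_surj_on[OF bij] by simp
  then have gr: "is_graph X" "is_graph (\<psi> ` X)"
    using is_graph_subset[OF assms(1,4)] is_graph_subset[OF assms(2)] by auto
  have "M X Y \<longleftrightarrow> M (\<psi> ` X) (\<psi> ` Y)" if "Y \<subseteq> X" for Y
  proof -
    have "Y \<subseteq> G" "\<psi> ` Y \<subseteq> H" "\<psi> ` Y \<subseteq> \<psi> ` X" using that assms(4) \<open>\<psi> ` X \<subseteq> H\<close> by auto
    moreover from this have "M G Y \<longleftrightarrow> M H (\<psi> ` Y)" using assms(3) unfolding matroid_iso_def by simp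
    ultimately show ?thesis
      using M_iff_ind[OF assms(1)] M_iff_ind[OF assms(2)] M_iff_ind[OF gr(1)] M_iff_ind[OF gr(2)] that by simp
  qed
  moreover have "bij_betw \<psi> X (\<psi> ` X)" using bij assms(4) by (meson bij_betw_subset)
  ultimately show ?thesis unfolding matroid_iso_def by simp
qed

end

text \<open>Here \<open>d\<close> is the eventual increment of \<open>kr\<close>, \<open>N\<close>
  the threshold from which it holds, and \<open>c\<close> a connectivity forcing rigidity. Taking
  \<open>N \<le> c\<close> places every \<open>c\<close>-connected graph where \<open>kr\<close> is
  linear.\<close>

locale lovasz_yemini = graph_matroids +
  fixes d N c :: nat
  assumes kr_Suc: "\<And>n. N \<le> n \<Longrightarrow> kr (Suc n) = kr n + d"
    and d_pos: "1 \<le> d"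
    and N_le_c: "N \<le> c"
    and c_pos: "1 \<le> c"
    and rigid: "\<And>G. is_graph G \<Longrightarrow> k_connected c G \<Longrightarrow> rigid M G"
begin

section \<open>Rank gained by attaching new vertices\<close>

lemma kr_add: "N \<le> n \<Longrightarrow> kr (n + j) = kr n + d * j"
  by (induction j) (auto simp: kr_Suc)

lemma kr_le: "kr n \<le> kr N + d * n"
proof (cases "N \<le> n")
  case True
  then show ?thesis using kr_add[of N "n - N"] by simp
next
  case False
  then show ?thesis using kr_mono[of n N] by simp
qed

lemma kr_inj:
  assumes "N \<le> m" "N \<le> n" "kr m = kr n"
  shows "m = n"
proof (rule ccontr)
  assume "m \<noteq> n"
  then show False using assms kr_add[of m "n - m"] kr_add[of n "m - n"] d_pos by (cases "m < n") auto
qed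

text \<open>By submodularity a star gains at least as much over \<open>L\<close> as over a larger
  graph avoiding \<open>w\<close>, here a complete one, where the gain is known.\<close>

lemma rank_add_star:
  assumes L: "is_graph L" "w \<notin> verts L" and S: "finite S" "w \<notin> S"
  shows "r L + min d (card S) \<le> r (L \<union> star w S)"
proof -
  \<comment> \<open>The interval pads \<open>V\<close> to at least \<open>N\<close> vertices and
    starts at \<open>Suc w\<close> to avoid \<open>w\<close>.\<close>
  define V where "V = verts L \<union> S \<union> {Suc w..<Suc w + N}"
  have V: "finite V" "w \<notin> V" "S \<subseteq> V" "verts L \<subseteq> V"
    using assms finite_verts unfolding V_def by auto
  have "card {Suc w..<Suc w + N} \<le> card V" using V(1) by (intro card_mono) (auto simp: V_def)
  then have "N \<le> card V" by simp
  then have *: "r (complete_graph V) + min d (card S) \<le> r (complete_graph V \<union> star w S)"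
    using V by (intro rank_complete_add_star) (auto simp: kr_Suc)
  have LK: "L \<subseteq> complete_graph V" using L V subset_complete by blast
  have "r ((L \<union> star w S) \<union> complete_graph V) + r L \<le> r (L \<union> star w S) + r (complete_graph V)"
    using LK V S L by (intro rank_submodular_subset is_graph_Un is_graph_star is_graph_complete) auto
  moreover have "(L \<union> star w S) \<union> complete_graph V = complete_graph V \<union> star w S" using LK by auto
  ultimately show ?thesis using * by simp
qed

text \<open>All leaves lie outside \<open>W\<close>, so each centre is still a new vertex when its
  star is attached.\<close>

lemma rank_add_stars:
  assumes "finite W" "is_graph L" "verts L \<inter> W = {}" "\<And>w. w \<in> W \<Longrightarrow> finite (S w) \<and> S w \<inter> W = {}"
  shows "r L + (\<Sum>w\<in>W. min d (card (S w))) \<le> r (L \<union> (\<Union>w\<in>W. star w (S w)))"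
  using assms
proof (induction W rule: finite_induct)
  case (insert w W)
  let ?L = "L \<union> (\<Union>w\<in>W. star w (S w))"
  have "is_graph (\<Union>w\<in>W. star w (S w))"
    using insert by (intro is_graph_UN is_graph_star) blast+
  then have gr: "is_graph ?L" using insert.prems(1) is_graph_Un by blast
  have "w \<notin> verts (\<Union>w\<in>W. star w (S w))"
    using insert.hyps(2) insert.prems(3) unfolding verts_def star_def by auto
  then have "w \<notin> verts ?L" using insert.prems(2) unfolding verts_def by auto
  then have "r ?L + min d (card (S w)) \<le> r (?L \<union> star w (S w))"
    using gr insert.prems(3)[of w] by (intro rank_add_star) auto
  moreover have "r L + (\<Sum>w\<in>W. min d (card (S w))) \<le> r ?L"
    using insert.prems by (intro insert.IH) auto
  moreover have "L \<union> (\<Union>w\<in>insert w W. star w (S w)) = ?L \<union> star w (S w)" by auto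
  ultimately show ?case using insert.hyps by simp
qed simp

text \<open>Discarding the edges inside \<open>W\<close> leaves stars of the shape required by
  \<open>rank_add_stars\<close>.\<close>

lemma rank_ge_nbhds:
  assumes "is_graph F" "L \<subseteq> F" "finite W" "verts L \<inter> W = {}"
  shows "r L + (\<Sum>w\<in>W. min d (card (nbhd F w - W))) \<le> r F"
proof -
  have "r L + (\<Sum>w\<in>W. min d (card (nbhd F w - W))) \<le> r (L \<union> (\<Union>w\<in>W. star w (nbhd F w - W)))"
    using assms finite_nbhd[OF assms(1)] is_graph_subset[OF assms(1,2)] by (intro rank_add_stars) auto
  also have "\<dots> \<le> r F"
  proof (rule rank_mono[OF assms(1)])
    have "star w (nbhd F w - W) \<subseteq> F" for w using star_nbhd[of w F] star_mono[of "nbhd F w - W" "nbhd F w"] by blast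
    then show "L \<union> (\<Union>w\<in>W. star w (nbhd F w - W)) \<subseteq> F" using assms(2) by blast
  qed
  finally show ?thesis .
qed

section \<open>Vertex deletion and edge colourings in highly connected graphs\<close>

lemma rank_connected:
  assumes "is_graph G" "k_connected c G"
  shows "r G = kr (card (verts G))"
  using rigid[OF assms] rigid_iff assms by simp

text \<open>Both \<open>G\<close> and \<open>del_verts G Y\<close> are rigid and have at least
  \<open>N\<close> vertices, where \<open>kr\<close> has slope \<open>d\<close>.\<close>

lemma rank_del_verts:
  assumes G: "is_graph G" and con: "k_connected (c + j) G" and Y: "Y \<subseteq> verts G" "card Y \<le> j"
  shows "r (del_verts G Y) + d * card Y = r G"
proof -
  have gr: "is_graph (del_verts G Y)" using is_graph_subset[OF G] unfolding del_verts_def by auto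
  have 1: "r (del_verts G Y) = kr (card (verts G - Y))"
    using rank_connected[OF gr] verts_del_verts[OF G con c_pos Y] k_connected_del_verts[OF G con c_pos Y] by simp
  have 2: "r G = kr (card (verts G))" using rank_connected[OF G] k_connected_mono[OF con] by simp
  have fin: "finite Y" using Y finite_verts[OF G] finite_subset by blast
  have 3: "card (verts G) = card (verts G - Y) + card Y"
    using Y fin card_mono[OF finite_verts[OF G] Y(1)] by (simp add: card_Diff_subset)
  have "c + j < card (verts G)" using con unfolding k_connected_def by simp
  then have "N \<le> card (verts G - Y)" using 3 Y N_le_c by simp
  then show ?thesis using 1 2 3 kr_add by simp
qed

text \<open>Deleting \<open>W\<close> costs \<open>G\<close> exactly \<open>d\<close> per vertex,
  whereas attaching \<open>W\<close> again in each colour separately gains at least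
  \<open>d + 1\<close> per vertex in total, which leaves an excess of one each.\<close>

lemma rank_two_coloured:
  assumes G: "is_graph G" and con: "k_connected (c + m + 2 * d) G" and AB: "G = A \<union> B"
    and W: "W \<subseteq> verts G" "card W \<le> m"
    and col: "\<And>w. w \<in> W \<Longrightarrow> nbhd A w - W \<noteq> {} \<and> nbhd B w - W \<noteq> {}"
  shows "r G + card W \<le> r A + r B"
proof -
  let ?Z = "del_verts G W"
  have finW: "finite W" using W finite_verts[OF G] finite_subset by blast
  have gA: "is_graph A" and gB: "is_graph B" using is_graph_subset[OF G] AB by auto
  have "k_connected (c + m) G" using k_connected_mono[OF con] by simp
  then have Z: "r ?Z + d * card W = r G" using rank_del_verts[OF G _ W] by simp
  have vZ: "verts ?Z \<inter> W = {}" unfolding verts_def del_verts_def by auto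
  have A: "r (A \<inter> ?Z) + (\<Sum>w\<in>W. min d (card (nbhd A w - W))) \<le> r A"
    using vZ verts_mono[of "A \<inter> ?Z" ?Z] by (intro rank_ge_nbhds gA finW) auto
  have B: "r (B \<inter> ?Z) + (\<Sum>w\<in>W. min d (card (nbhd B w - W))) \<le> r B"
    using vZ verts_mono[of "B \<inter> ?Z" ?Z] by (intro rank_ge_nbhds gB finW) auto
  have "A \<inter> ?Z \<union> B \<inter> ?Z = ?Z" using AB unfolding del_verts_def by auto
  then have AB': "r ?Z \<le> r (A \<inter> ?Z) + r (B \<inter> ?Z)"
    using rank_Un_le[of "A \<inter> ?Z" "B \<inter> ?Z"] is_graph_subset[OF gA, of "A \<inter> ?Z"] is_graph_subset[OF gB, of "B \<inter> ?Z"] by simp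
  \<comment> \<open>At most \<open>m\<close> neighbours of \<open>w\<close> lie in \<open>W\<close>,
    so the two counts add up to at least \<open>2 * d\<close>. Hence one of the minima is
    \<open>d\<close>, and the other is at least \<open>1\<close> because both colours are
    present.\<close>
  have w: "d + 1 \<le> min d (card (nbhd A w - W)) + min d (card (nbhd B w - W))" if "w \<in> W" for w
  proof -
    have "c + m + 2 * d \<le> card (nbhd G w)" using k_connected_card_nbhd[OF G con] that W by auto
    also have "\<dots> \<le> card (W \<union> ((nbhd A w - W) \<union> (nbhd B w - W)))"
      using AB nbhd_Un[of A B w] finW finite_nbhd[OF gA] finite_nbhd[OF gB] by (intro card_mono) auto
    also have "\<dots> \<le> card W + (card (nbhd A w - W) + card (nbhd B w - W))"
      using card_Un_le[of W "(nbhd A w - W) \<union> (nbhd B w - W)"] card_Un_le[of "nbhd A w - W" "nbhd B w - W"] by linarith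
    finally have "2 * d \<le> card (nbhd A w - W) + card (nbhd B w - W)" using W by simp
    moreover have "0 < card (nbhd A w - W)" "0 < card (nbhd B w - W)"
      using col[OF that] finite_nbhd[OF gA] finite_nbhd[OF gB] by (auto simp: card_gt_0_iff)
    ultimately show ?thesis using d_pos by (auto simp: min_def)
  qed
  have "card W * (d + 1) = (\<Sum>w\<in>W. d + 1)" by simp
  also have "\<dots> \<le> (\<Sum>w\<in>W. min d (card (nbhd A w - W)) + min d (card (nbhd B w - W)))"
    by (rule sum_mono) (rule w)
  also have "\<dots> = (\<Sum>w\<in>W. min d (card (nbhd A w - W))) + (\<Sum>w\<in>W. min d (card (nbhd B w - W)))"
    by (rule sum.distrib)
  finally have "card W * d + card W \<le> (\<Sum>w\<in>W. min d (card (nbhd A w - W))) + (\<Sum>w\<in>W. min d (card (nbhd B w - W)))"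
    by simp
  then show ?thesis using A B AB' Z by (simp add: mult.commute)
qed

text \<open>
  Take \<open>W\<close> maximal such that each of its vertices sends edges of both colours out of \<open>W\<close>, and \<open>P\<close> a
  set of witnessing neighbours. Every other vertex sends edges of a single colour out of \<open>W\<close>, and by
  connectivity this is the same colour for all of them.
\<close>

lemma small_side:
  assumes G: "is_graph G" and con: "k_connected (c + 4 * m + 2 * d) G" and AB: "G = A \<union> B"
    and small: "r A + r B < r G + m"
  shows "card (verts A) \<le> 4 * m \<or> card (verts B) \<le> 4 * m"
proof -
  let ?V = "verts G"
  have finV: "finite ?V" using finite_verts[OF G] .
  have con1: "k_connected (c + m + 2 * d) G" using k_connected_mono[OF con] by simp
  have gA: "is_graph A" and gB: "is_graph B" using is_graph_subset[OF G] AB by auto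
  define good where "good W \<longleftrightarrow> W \<subseteq> ?V \<and> (\<forall>w\<in>W. nbhd A w - W \<noteq> {} \<and> nbhd B w - W \<noteq> {})" for W
  \<comment> \<open>Subsets of a good set are good, so one of exactly \<open>m\<close> vertices
    would produce an excess of \<open>m\<close>.\<close>
  have good_small: "card W < m" if "good W" for W
  proof (rule ccontr)
    assume "\<not> card W < m"
    then obtain W' where W': "W' \<subseteq> W" "card W' = m" by (metis obtain_subset_with_card_n linorder_not_less)
    have "r G + card W' \<le> r A + r B"
      by (rule rank_two_coloured[OF G con1 AB]) (use that W' in \<open>auto simp: good_def, blast+\<close>)
    then show False using W' small by simp
  qed
  have "finite {W. good W}" by (rule finite_subset[of _ "Pow ?V"]) (auto simp: good_def finV)
  moreover have "{} \<in> {W. good W}" unfolding good_def by auto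
  ultimately obtain W where W: "good W" and Wmax: "\<And>W'. good W' \<Longrightarrow> W \<subseteq> W' \<Longrightarrow> W = W'"
    using finite_has_maximal[of "{W. good W}"] by auto
  have mW: "card W < m" using good_small[OF W] .
  have WV: "W \<subseteq> ?V" using W unfolding good_def by simp
  have finW: "finite W" using WV finV finite_subset by blast
  have "\<forall>w\<in>W. \<exists>x. x \<in> nbhd A w - W" "\<forall>w\<in>W. \<exists>x. x \<in> nbhd B w - W" using W unfolding good_def by auto
  then obtain p q where p: "\<And>w. w \<in> W \<Longrightarrow> p w \<in> nbhd A w - W" and q: "\<And>w. w \<in> W \<Longrightarrow> q w \<in> nbhd B w - W"
    by metis
  define P where "P = p ` W \<union> q ` W"
  have cP: "card P \<le> 2 * m" "finite P"
    using card_Un_le[of "p ` W" "q ` W"] card_image_le[OF finW, of p] card_image_le[OF finW, of q] mW finW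
    unfolding P_def by auto
  define U where "U = ?V - (W \<union> P)"
  \<comment> \<open>Otherwise \<open>x\<close> could join \<open>W\<close>, against maximality: as
    \<open>x\<close> is not in \<open>P\<close>, the witnesses \<open>p w\<close> and
    \<open>q w\<close> stay outside the larger set.\<close>
  have mono: "nbhd A x - W = {} \<or> nbhd B x - W = {}" if x: "x \<in> U" for x
  proof (rule ccontr)
    assume neg: "\<not> ?thesis"
    have "x \<notin> nbhd A x" "x \<notin> nbhd B x" using nbhd_not_self gA gB by auto
    then have "nbhd A x - insert x W \<noteq> {}" "nbhd B x - insert x W \<noteq> {}" using neg by auto
    moreover have "p w \<in> nbhd A w - insert x W" "q w \<in> nbhd B w - insert x W" if "w \<in> W" for w
      using p[OF that] q[OF that] x that unfolding U_def P_def by auto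
    ultimately have "good (insert x W)" using WV x unfolding good_def U_def by blast
    then have "W = insert x W" using Wmax by blast
    then show False using x unfolding U_def by auto
  qed
  have cWP: "card (W \<union> P) < c + 4 * m + 2 * d" using card_Un_le[of W P] cP mW by simp
  have "p w \<in> ?V" "q w \<in> ?V" if "w \<in> W" for w
    using p[OF that] q[OF that] nbhd_subset[of A w] nbhd_subset[of B w] verts_mono[of A G] verts_mono[of B G] AB
    by blast+
  then have WP: "W \<union> P \<subseteq> ?V" using WV unfolding P_def by blast
  have conU: "connected_on U G" using con WP cWP unfolding k_connected_def U_def by blast
  \<comment> \<open>Vertices of \<open>U\<close> have \<open>A'\<close>-edges only into
    \<open>W\<close>. Those with such an edge form \<open>Y\<close>; any \<open>m\<close> of them
    would send both colours out of their set, so \<open>card Y < m\<close>. With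
    \<open>card W < m\<close> and \<open>card P \<le> 2 * m\<close> this gives
    \<open>4 * m\<close>.\<close>
  have one_side: "card (verts A') \<le> 4 * m"
    if AB': "G = A' \<union> B'" and small': "r A' + r B' < r G + m" and mono': "\<And>x. x \<in> U \<Longrightarrow> nbhd A' x - W = {}" for A' B'
  proof -
    have gA': "is_graph A'" using is_graph_subset[OF G] AB' by auto
    define Y where "Y = {y \<in> U. nbhd A' y \<inter> W \<noteq> {}}"
    have YV: "Y \<subseteq> ?V" unfolding Y_def U_def by auto
    have finY: "finite Y" using YV finV finite_subset by blast
    have "card Y < m"
    proof (rule ccontr)
      assume "\<not> card Y < m"
      then obtain Y' where Y': "Y' \<subseteq> Y" "card Y' = m" by (metis obtain_subset_with_card_n linorder_not_less)
      have "r G + card Y' \<le> r A' + r B'"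
      proof (rule rank_two_coloured[OF G con1 AB'])
        fix y assume y: "y \<in> Y'"
        then have yU: "y \<in> U" "nbhd A' y \<inter> W \<noteq> {}" using Y' unfolding Y_def by auto
        have "Y' \<inter> W = {}" using Y' unfolding Y_def U_def by auto
        then have "nbhd A' y - Y' \<noteq> {}" using yU by blast
        \<comment> \<open>The degree of \<open>y\<close> leaves a neighbour outside \<open>W\<close>
          and \<open>Y'\<close>; the edge to it is not in \<open>A'\<close>, hence in
          \<open>B'\<close>.\<close>
        moreover have "card (W \<union> Y') < card (nbhd G y)"
          using card_Un_le[of W Y'] mW Y' k_connected_card_nbhd[OF G con, of y] yU unfolding U_def by auto
        then obtain z where z: "z \<in> nbhd G y" "z \<notin> W \<union> Y'"
          using ex_mem_not_in[of "W \<union> Y'" "nbhd G y"] finW finite_subset[OF Y'(1) finY] by auto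
        then have "z \<in> nbhd B' y" using mono'[OF yU(1)] AB' nbhd_Un by blast
        ultimately show "nbhd A' y - Y' \<noteq> {} \<and> nbhd B' y - Y' \<noteq> {}" using z by blast
      qed (use Y' YV in auto)
      then show False using Y' small' by simp
    qed
    moreover have "verts A' \<subseteq> (W \<union> P) \<union> Y"
    proof
      fix v assume v: "v \<in> verts A'"
      then obtain e where e: "e \<in> A'" "v \<in> e" unfolding verts_def by auto
      then obtain x where "e = {v, x}" using is_graph_edgeE[OF gA' e(1)] by (metis doubleton_eq_iff insertE singletonD)
      then have x: "x \<in> nbhd A' v" using e unfolding nbhd_def by simp
      have "v \<in> ?V" using v verts_mono[of A' G] AB' by auto
      then show "v \<in> (W \<union> P) \<union> Y" using x mono'[of v] unfolding Y_def U_def by blast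
    qed
    then have "card (verts A') \<le> card ((W \<union> P) \<union> Y)" using finW cP finY by (intro card_mono) auto
    then have "card (verts A') \<le> card W + card P + card Y"
      using card_Un_le[of "W \<union> P" Y] card_Un_le[of W P] by linarith
    ultimately show ?thesis using mW cP by linarith
  qed
  have "card (W \<union> P) < card ?V" using cWP con unfolding k_connected_def by linarith
  then obtain u where u: "u \<in> U" using ex_mem_not_in[of "W \<union> P" ?V] finW cP unfolding U_def by auto
  \<comment> \<open>For an edge \<open>{x, y}\<close> inside \<open>U\<close>, if \<open>x\<close>
    has no \<open>A'\<close>-neighbour outside \<open>W\<close>, the edge is in \<open>B'\<close>;
    so by \<open>mono\<close> neither has \<open>y\<close>. The pair \<open>(A', B')\<close> lets
    one argument cover both colours.\<close>
  have same_colour: "nbhd A' x - W = {}"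
    if "nbhd A' u - W = {}" "x \<in> U" and AB': "(A', B') = (A, B) \<or> (A', B') = (B, A)" for A' B' x
  proof (rule connected_on_invariant[OF conU u that(2), of "\<lambda>x. nbhd A' x - W = {}"])
    fix x y assume xy: "x \<in> U" "y \<in> U" "{x, y} \<in> G" "nbhd A' x - W = {}"
    then have "y \<notin> nbhd A' x" unfolding U_def by blast
    then have "x \<in> nbhd B' y" using xy(3) AB AB' unfolding nbhd_def by (auto simp: insert_commute)
    then have "nbhd B' y - W \<noteq> {}" using xy(1) unfolding U_def by blast
    then show "nbhd A' y - W = {}" using mono[OF xy(2)] AB' by auto
  qed (use that in auto)
  from mono[OF u] show ?thesis
  proof
    assume "nbhd A u - W = {}"
    then have "card (verts A) \<le> 4 * m" using same_colour[of A _ B] by (intro one_side[OF AB small]) auto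
    then show ?thesis ..
  next
    assume 1: "nbhd B u - W = {}"
    have "card (verts B) \<le> 4 * m" using same_colour[of B _ A, OF 1] AB small by (intro one_side[of B A]) auto
    then show ?thesis ..
  qed
qed

section \<open>Graphs with the same matroid as a highly connected graph\<close>

text \<open>Let \<open>Y\<close> contain one end of each edge of \<open>T\<close>. Deleting
  \<open>Y\<close> removes \<open>T\<close> altogether, and every vertex of \<open>Y\<close> regains
  \<open>d\<close> inside \<open>G - T\<close>: of its at least \<open>c + 2 * t + d\<close>
  neighbours, at most \<open>t\<close> are lost through \<open>T\<close> and at most
  \<open>t\<close> lie in \<open>Y\<close>.\<close>

lemma rank_del_edges:
  assumes G: "is_graph G" and con: "k_connected (c + 2 * t + d) G" and T: "T \<subseteq> G" "card T \<le> t"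
  shows "r (G - T) = r G"
proof -
  have finT: "finite T" using T(1) G finite_subset unfolding is_graph_def by blast
  have "\<exists>x. x \<in> e" if "e \<in> T" for e using is_graph_edgeE[OF G, of e] T that by blast
  then obtain p where p: "\<And>e. e \<in> T \<Longrightarrow> p e \<in> e" by metis
  define Y where "Y = p ` T"
  have finY: "finite Y" and cY: "card Y \<le> t"
    using finT card_image_le[OF finT, of p] T unfolding Y_def by auto
  have YV: "Y \<subseteq> verts G" using p T unfolding Y_def verts_def by blast
  have gT: "is_graph T" and gGT: "is_graph (G - T)" using is_graph_subset[OF G] T by auto
  have "k_connected (c + t) G" using k_connected_mono[OF con] by simp
  then have Z: "r (del_verts G Y) + d * card Y = r G" using rank_del_verts[OF G _ YV cY] by simp
  have ZT: "del_verts G Y \<subseteq> G - T" using p unfolding del_verts_def Y_def by blast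
  have vZ: "verts (del_verts G Y) \<inter> Y = {}" unfolding verts_def del_verts_def by auto
  have "d \<le> card (nbhd (G - T) y - Y)" if "y \<in> Y" for y
  proof -
    have "card (nbhd T y) \<le> card T"
      using card_star[of y "nbhd T y"] card_mono[OF finT star_nbhd[of y T]] by simp
    moreover have "c + 2 * t + d \<le> card (nbhd G y)" using k_connected_card_nbhd[OF G con] that YV by auto
    moreover have "card (nbhd G y) \<le> card ((nbhd (G - T) y - Y) \<union> (nbhd T y \<union> Y))"
    proof (rule card_mono)
      show "nbhd G y \<subseteq> (nbhd (G - T) y - Y) \<union> (nbhd T y \<union> Y)" unfolding nbhd_def by blast
    qed (use finY finite_nbhd[OF gT] finite_nbhd[OF gGT] in simp)
    ultimately show ?thesis
      using card_Un_le[of "nbhd (G - T) y - Y" "nbhd T y \<union> Y"] card_Un_le[of "nbhd T y" Y] cY T(2) by linarith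
  qed
  then have "(\<Sum>y\<in>Y. d) \<le> (\<Sum>y\<in>Y. min d (card (nbhd (G - T) y - Y)))" by (intro sum_mono) simp
  then have "r (del_verts G Y) + d * card Y \<le> r (G - T)"
    using rank_ge_nbhds[OF gGT ZT finY vZ] by (simp add: mult.commute)
  then show ?thesis using Z rank_mono[OF G, of "G - T"] by simp
qed

text \<open>A star of at most \<open>t\<close> edges at \<open>w\<close> would pull back to edges
  that \<open>G\<close> can lose without loss of rank, whereas \<open>H\<close> loses rank with a
  whole nonempty star, as \<open>1 \<le> d\<close>.\<close>

lemma iso_min_degree:
  assumes G: "is_graph G" and H: "is_graph H" and iso: "matroid_iso \<psi> G (M G) H (M H)"
    and con: "k_connected (c + 2 * t + d) G" and w: "w \<in> verts H"
  shows "t < card (nbhd H w)"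
proof (rule ccontr)
  assume "\<not> t < card (nbhd H w)"
  then have t: "card (nbhd H w) \<le> t" by simp
  let ?S = "star w (nbhd H w)" and ?L = "del_verts H {w}"
  have bij: "bij_betw \<psi> G H" using iso unfolding matroid_iso_def by simp
  then have inj: "inj_on \<psi> G" and im: "\<psi> ` G = H" unfolding bij_betw_def by auto
  obtain T where T: "T \<subseteq> G" "\<psi> ` T = ?S" using subset_imageE[of ?S \<psi> G] star_nbhd[of w H] im by metis
  have "card T = card ?S" using T card_image[OF inj_on_subset[OF inj T(1)]] by simp
  then have "r (G - T) = r G" using rank_del_edges[OF G con T(1)] t card_star by simp
  moreover have "r (\<psi> ` (G - T)) = r (G - T)" "r (\<psi> ` G) = r G"
    using rank_matroid_iso[OF G H iso] by auto
  moreover have "\<psi> ` (G - T) = H - ?S" using inj_on_image_set_diff[OF inj, of G T] T im by simp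
  ultimately have eq: "r (H - ?S) = r H" using im by simp
  have "H - ?S \<subseteq> ?L" using split_at_vertex[OF H, of w] by blast
  moreover have gL: "is_graph ?L" using is_graph_subset[OF H] unfolding del_verts_def by auto
  ultimately have "r (H - ?S) \<le> r ?L" using rank_mono by blast
  moreover have "r ?L + min d (card (nbhd H w)) \<le> r (?L \<union> ?S)"
  proof (rule rank_add_star[OF gL])
    show "w \<notin> verts ?L" unfolding verts_def del_verts_def by auto
  qed (use finite_nbhd[OF H] nbhd_not_self[OF H] in auto)
  moreover have "nbhd H w \<noteq> {}"
  proof -
    obtain e where e: "e \<in> H" "w \<in> e" using w unfolding verts_def by auto
    then have "e \<notin> ?L" unfolding del_verts_def by auto
    then have "e \<in> ?S" using split_at_vertex[OF H, of w] e by blast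
    then show ?thesis unfolding star_def by auto
  qed
  then have "0 < card (nbhd H w)" using finite_nbhd[OF H] by (simp add: card_gt_0_iff)
  ultimately show False using eq split_at_vertex[OF H, of w] d_pos by simp
qed

text \<open>For a separation \<open>(H\<^sub>1, H\<^sub>2)\<close> of order less than \<open>c\<close>, \<open>cut_bound\<close> exceeds \<open>r H\<^sub>1 + r H\<^sub>2 - r H\<close>.\<close>

definition cut_bound :: nat where
  "cut_bound = kr N + d * (c + d) + 1"

text \<open>The square bounds the number of edges on \<open>4 * cut_bound\<close> vertices, the size
  given by \<open>small_side\<close>; the summand \<open>c + d\<close> guarantees at least
  \<open>d\<close> vertices on a side of a cut.\<close>

definition degree_bound :: nat where
  "degree_bound = (4 * cut_bound) * (4 * cut_bound) + c + d"

text \<open>Large enough for \<open>iso_min_degree\<close> with \<open>t = degree_bound\<close> and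
  for \<open>small_side\<close> with \<open>m = cut_bound\<close>.\<close>

definition conn_bound :: nat where
  "conn_bound = c + 2 * degree_bound + 4 * cut_bound + 2 * d"

text \<open>A cut of fewer than \<open>c\<close> vertices would split the edges of \<open>H\<close>
  into \<open>H1\<close> and \<open>H2\<close> with excess below \<open>cut_bound\<close>. Pulling
  back to \<open>G\<close>, \<open>small_side\<close> leaves one part with few edges, but each
  contains the full star of some vertex and so more than \<open>degree_bound\<close> edges.\<close>

lemma iso_connected:
  assumes G: "is_graph G" and H: "is_graph H" and iso: "matroid_iso \<psi> G (M G) H (M H)"
    and con: "k_connected conn_bound G"
  shows "k_connected c H"
proof -
  have bij: "bij_betw \<psi> G H" using iso unfolding matroid_iso_def by simp
  then have inj: "inj_on \<psi> G" and im: "\<psi> ` G = H" unfolding bij_betw_def by auto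
  have "k_connected (c + 2 * degree_bound + d) G"
    by (rule k_connected_mono[OF con]) (simp add: conn_bound_def)
  then have deg: "degree_bound < card (nbhd H w)" if "w \<in> verts H" for w
    using iso_min_degree[OF G H iso _ that] by blast
  have con1: "k_connected (c + 4 * cut_bound + 2 * d) G"
    by (rule k_connected_mono[OF con]) (simp add: conn_bound_def)
  have finV: "finite (verts H)" using finite_verts[OF H] .
  have "G \<noteq> {}" using con unfolding k_connected_def verts_def by auto
  then have "H \<noteq> {}" using im by auto
  then obtain e where "e \<in> H" by auto
  moreover obtain w z where "e = {w, z}" using is_graph_edgeE[OF H \<open>e \<in> H\<close>] by metis
  ultimately have w: "w \<in> verts H" unfolding verts_def by blast
  have "card (nbhd H w) \<le> card (verts H)" using nbhd_subset finV by (intro card_mono) auto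
  then have "c + 1 \<le> card (verts H)" using deg[OF w] unfolding degree_bound_def by simp
  moreover have "connected_on (verts H - X) H" if X: "X \<subseteq> verts H" "card X < c" for X
  proof (rule ccontr)
    assume "\<not> connected_on (verts H - X) H"
    then obtain U where U: "U \<subseteq> verts H - X" "U \<noteq> {}" "verts H - X - U \<noteq> {}"
      and sep: "\<And>x y. x \<in> U \<Longrightarrow> y \<in> verts H - X - U \<Longrightarrow> {x, y} \<notin> H"
      by (rule not_connected_on_split) blast
    define U' where "U' = verts H - X - U"
    have finX: "finite X" and finU': "finite U'" using finV X finite_subset unfolding U'_def by auto
    define H1 where "H1 = {e \<in> H. e \<inter> U \<noteq> {}}"
    define H2 where "H2 = {e \<in> H. e \<inter> U = {}}"
    have H12: "H = H1 \<union> H2" unfolding H1_def H2_def by auto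
    have gH: "is_graph H1" "is_graph H2" using is_graph_subset[OF H] H12 by auto
    have nb: "nbhd H y \<subseteq> U' \<union> X" if "y \<in> U'" for y
    proof
      fix x assume x: "x \<in> nbhd H y"
      then have "{x, y} \<in> H" unfolding nbhd_def by (simp add: insert_commute)
      then have "x \<notin> U" using sep[of x y] that unfolding U'_def by blast
      then show "x \<in> U' \<union> X" using x nbhd_subset[of H y] unfolding U'_def by blast
    qed
    have U'H1: "y \<notin> e" if yU: "y \<in> U'" and eH: "e \<in> H1" for y e
    proof
      assume "y \<in> e"
      obtain x where x: "x \<in> e" "x \<in> U" "e \<in> H" using eH unfolding H1_def by auto
      then have "x \<noteq> y" using yU unfolding U'_def by auto
      then have "e = {x, y}" using is_graph_edgeE[OF H x(3)] x(1) \<open>y \<in> e\<close> by (metis doubleton_eq_iff insertE singletonD)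
      then show False using sep[OF x(2)] yU x(3) unfolding U'_def by blast
    qed
    have "verts H2 \<subseteq> U' \<union> X"
    proof -
      have "verts H2 \<subseteq> verts H" using H12 by (intro verts_mono) auto
      moreover have "verts H2 \<inter> U = {}" unfolding verts_def H2_def by auto
      ultimately show ?thesis unfolding U'_def by blast
    qed
    \<comment> \<open>By submodularity, enlarging \<open>H2\<close> to the complete graph
      \<open>K\<close> can only increase the excess, and for \<open>K\<close> the ranks can be
      estimated.\<close>
    define K where "K = complete_graph (U' \<union> X)"
    have gK: "is_graph K" unfolding K_def using finU' finX by (simp add: is_graph_complete)
    have H2K: "H2 \<subseteq> K" unfolding K_def using gH \<open>verts H2 \<subseteq> U' \<union> X\<close> by (intro subset_complete)
    have gHK: "is_graph (H \<union> K)" using H gK by (rule is_graph_Un)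
    have 1: "r (H \<union> K) + r H2 \<le> r H + r K"
      using H gK H2K H12 by (intro rank_submodular_subset) auto
    have "card (U' \<union> X) \<le> card U' + c" using card_Un_le[of U' X] X by linarith
    then have "d * card (U' \<union> X) \<le> d * (card U' + c)" by (rule mult_le_mono2)
    moreover have "r K = kr (card (U' \<union> X))" using rank_complete finU' finX unfolding K_def by simp
    ultimately have 2: "r K \<le> kr N + d * (card U' + c)" using kr_le[of "card (U' \<union> X)"] by linarith
    obtain y where y: "y \<in> U'" using U(3) unfolding U'_def by auto
    have "card (nbhd H y) \<le> card (U' \<union> X)" using nb[OF y] finU' finX by (intro card_mono) auto
    moreover have "degree_bound < card (nbhd H y)" using deg y unfolding U'_def by blast
    ultimately have dU': "d \<le> card U'"
      using card_Un_le[of U' X] X unfolding degree_bound_def by linarith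
    \<comment> \<open>Any \<open>d\<close> vertices of \<open>U'\<close> are common neighbours in
      \<open>K\<close> of all the others, each of which then adds \<open>d\<close> to
      \<open>r H1\<close>. So \<open>card U'\<close> cancels between the bounds \<open>2\<close> and
      \<open>3\<close>, leaving \<open>kr N + d * (c + d)\<close>.\<close>
    then obtain P where P: "P \<subseteq> U'" "card P = d" using obtain_subset_with_card_n by blast
    have finP: "finite P" using P finU' finite_subset by blast
    define W where "W = U' - P"
    have finW: "finite W" using finU' unfolding W_def by simp
    have "d \<le> card (nbhd (H \<union> K) w - W)" if "w \<in> W" for w
    proof -
      have "P \<subseteq> nbhd (H \<union> K) w - W"
        using P that unfolding W_def nbhd_def K_def complete_graph_def by blast
      then have "card P \<le> card (nbhd (H \<union> K) w - W)" using finite_nbhd[OF gHK] by (intro card_mono) auto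
      then show ?thesis using P by simp
    qed
    then have "(\<Sum>w\<in>W. d) \<le> (\<Sum>w\<in>W. min d (card (nbhd (H \<union> K) w - W)))" by (intro sum_mono) simp
    moreover have "verts H1 \<inter> W = {}" using U'H1 unfolding W_def verts_def by blast
    then have "r H1 + (\<Sum>w\<in>W. min d (card (nbhd (H \<union> K) w - W))) \<le> r (H \<union> K)"
      using H12 by (intro rank_ge_nbhds gHK finW) auto
    moreover have "card U' = card W + d" using P finP finU' dU' unfolding W_def by (simp add: card_Diff_subset)
    ultimately have 3: "r H1 + d * card U' \<le> r (H \<union> K) + d * d" by (simp add: algebra_simps)
    have sum: "r H1 + r H2 < r H + cut_bound"
      using 1 2 3 unfolding cut_bound_def by (simp add: algebra_simps)
    have "H1 \<subseteq> \<psi> ` G" "H2 \<subseteq> \<psi> ` G" using H12 im by auto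
    then obtain A B where A: "A \<subseteq> G" "\<psi> ` A = H1" and B: "B \<subseteq> G" "\<psi> ` B = H2"
      by (metis subset_imageE)
    have "\<psi> ` (A \<union> B) = \<psi> ` G" using A B H12 im by (simp add: image_Un)
    then have AB: "G = A \<union> B" using inj_on_image_eq_iff[OF inj, of "A \<union> B" G] A B by simp
    have "r H1 = r A" "r H2 = r B" "r H = r G"
      using rank_matroid_iso[OF G H iso] A B im by auto
    then have "card (verts A) \<le> 4 * cut_bound \<or> card (verts B) \<le> 4 * cut_bound"
      using sum by (intro small_side[OF G con1 AB]) simp
    moreover have "card D \<le> degree_bound" if "card (verts D) \<le> 4 * cut_bound" "D \<subseteq> G" for D
    proof -
      have "card D \<le> card (verts D) * card (verts D)" by (rule card_edges_le[OF is_graph_subset[OF G that(2)]])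
      also have "\<dots> \<le> (4 * cut_bound) * (4 * cut_bound)" using that(1) by (rule mult_le_mono) (rule that(1))
      finally show ?thesis unfolding degree_bound_def by simp
    qed
    moreover have "card A = card H1" "card B = card H2"
      using A B card_image[OF inj_on_subset[OF inj]] by metis+
    ultimately have small: "card H1 \<le> degree_bound \<or> card H2 \<le> degree_bound" using A(1) B(1) by metis
    have big: "degree_bound < card D" if "star x (nbhd H x) \<subseteq> D" "D \<subseteq> H" "x \<in> verts H" for x D
    proof -
      have "finite D" using that(2) H finite_subset unfolding is_graph_def by blast
      then show ?thesis using card_mono[OF _ that(1)] card_star[of x "nbhd H x"] deg[OF that(3)] by simp
    qed
    obtain x where x: "x \<in> U" using U(2) by auto
    have "star x (nbhd H x) \<subseteq> H1" using x star_nbhd[of x H] unfolding H1_def star_def by auto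
    then have "degree_bound < card H1" using x U(1) H12 by (intro big[of x]) auto
    moreover have "star y (nbhd H y) \<subseteq> H2"
    proof
      fix e assume e: "e \<in> star y (nbhd H y)"
      then have "y \<in> e" "e \<in> H" using star_nbhd[of y H] unfolding star_def by auto
      then show "e \<in> H2" using U'H1[OF y, of e] H12 by auto
    qed
    then have "degree_bound < card H2" using y H12 unfolding U'_def by (intro big[of y]) auto
    ultimately show False using small by simp
  qed
  ultimately show ?thesis unfolding k_connected_def by simp
qed

section \<open>Recovering the vertex map from the matroid isomorphism\<close>

lemma iso_same_order:
  assumes "is_graph G" "is_graph H" "matroid_iso \<psi> G (M G) H (M H)" "k_connected conn_bound G"
  shows "card (verts H) = card (verts G)"
proof -
  have cG: "k_connected c G" by (rule k_connected_mono[OF assms(4)]) (simp add: conn_bound_def)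
  have cH: "k_connected c H" by (rule iso_connected[OF assms])
  have "\<psi> ` G = H" using assms(3) unfolding matroid_iso_def bij_betw_def by simp
  then have "r H = r G" using rank_matroid_iso[OF assms(1-3) subset_refl] by simp
  then have "kr (card (verts H)) = kr (card (verts G))"
    using rank_connected[OF assms(1) cG] rank_connected[OF assms(2) cH] by simp
  moreover have "N \<le> card (verts H)" "N \<le> card (verts G)"
    using cG cH N_le_c unfolding k_connected_def by simp_all
  ultimately show ?thesis using kr_inj by blast
qed

text \<open>Deleting \<open>v\<close>, for which the extra \<open>1\<close> in the connectivity
  pays, leaves a graph whose image is \<open>c\<close>-connected, hence rigid, with one vertex fewer
  than \<open>H\<close>; the lost vertex is \<open>w\<close>.\<close>

lemma star_image:
  assumes G: "is_graph G" and H: "is_graph H" and iso: "matroid_iso \<psi> G (M G) H (M H)"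
    and con: "k_connected (conn_bound + 1) G" and v: "v \<in> verts G"
  shows "\<exists>w\<in>verts H. \<forall>e\<in>G. v \<in> e \<longleftrightarrow> w \<in> \<psi> e"
proof -
  let ?G = "del_verts G {v}"
  let ?H = "\<psi> ` ?G"
  have im: "\<psi> ` G = H" using iso unfolding matroid_iso_def bij_betw_def by simp
  have sub: "?G \<subseteq> G" unfolding del_verts_def by auto
  then have HH: "?H \<subseteq> H" using im by blast
  have gG: "is_graph ?G" and gH: "is_graph ?H" using is_graph_subset[OF G sub] is_graph_subset[OF H HH] by auto
  have iso': "matroid_iso \<psi> ?G (M ?G) ?H (M ?H)" by (rule matroid_iso_restrict[OF G H iso sub])
  have pos: "1 \<le> conn_bound" using c_pos unfolding conn_bound_def by simp
  have v1: "{v} \<subseteq> verts G" "card {v} \<le> 1" using v by auto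
  have con': "k_connected conn_bound ?G" by (rule k_connected_del_verts[OF G con pos v1])
  have vG: "verts ?G = verts G - {v}" by (rule verts_del_verts[OF G con pos v1])
  have cH: "k_connected c ?H" by (rule iso_connected[OF gG gH iso' con'])
  have "card (verts ?H) = card (verts G - {v})" using iso_same_order[OF gG gH iso' con'] vG by simp
  also have "\<dots> = card (verts G) - 1" using v by simp
  also have "card (verts G) = card (verts H)"
    using iso_same_order[OF G H iso] k_connected_mono[OF con] by simp
  finally have "card (verts ?H) = card (verts H) - 1" .
  moreover have "0 < card (verts H)" using \<open>card (verts G) = card (verts H)\<close> con unfolding k_connected_def by simp
  moreover have sv: "verts ?H \<subseteq> verts H" using HH by (rule verts_mono)
  ultimately have "card (verts H - verts ?H) = 1"
    using finite_verts[OF gH] by (simp add: card_Diff_subset)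
  then obtain w where w: "verts H - verts ?H = {w}" by (rule card_1_singletonE)
  have "v \<in> e \<longleftrightarrow> w \<in> \<psi> e" if e: "e \<in> G" for e
  proof
    \<comment> \<open>If \<open>\<psi> e\<close> avoided \<open>w\<close>, it would lie on the
      vertices of the rigid graph \<open>?H\<close> and not raise its rank, whereas
      \<open>e\<close>, attaching the new vertex \<open>v\<close>, raises the rank of
      \<open>?G\<close>.\<close>
    assume ve: "v \<in> e"
    show "w \<in> \<psi> e"
    proof (rule ccontr)
      assume "w \<notin> \<psi> e"
      moreover have "\<psi> e \<subseteq> verts H" using e im unfolding verts_def by blast
      moreover have "verts H \<subseteq> insert w (verts ?H)" using equalityD1[OF w] by blast
      ultimately have "\<psi> e \<subseteq> verts ?H" by blast
      then have "verts (insert (\<psi> e) ?H) \<subseteq> verts ?H" unfolding verts_def by auto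
      moreover have "insert (\<psi> e) ?H \<subseteq> H" using HH e im by blast
      then have "is_graph (insert (\<psi> e) ?H)" by (rule is_graph_subset[OF H])
      ultimately have "r (insert (\<psi> e) ?H) \<le> kr (card (verts ?H))"
        using finite_verts[OF gH] by (intro rank_le_kr)
      then have "r (insert (\<psi> e) ?H) \<le> r ?H" using rank_connected[OF gH cH] by simp
      moreover have "r (\<psi> ` insert e ?G) = r (insert e ?G)" "r ?H = r ?G"
        using e sub by (intro rank_matroid_iso[OF G H iso]; simp)+
      ultimately have "r (insert e ?G) \<le> r ?G" by simp
      moreover obtain u where u: "e = {v, u}" "u \<noteq> v"
        using is_graph_edgeE[OF G e] ve by (metis doubleton_eq_iff insertE singletonD)
      have "r ?G + min d (card {u}) \<le> r (?G \<union> star v {u})"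
        using u vG by (intro rank_add_star[OF gG]) auto
      then have "r ?G + 1 \<le> r (insert e ?G)" using u d_pos by (simp add: star_def)
      ultimately show False by simp
    qed
  next
    assume we: "w \<in> \<psi> e"
    show "v \<in> e"
    proof (rule ccontr)
      assume "v \<notin> e"
      then have "\<psi> e \<in> ?H" using e unfolding del_verts_def by auto
      then have "w \<in> verts ?H" using we unfolding verts_def by blast
      then show False using w by blast
    qed
  qed
  then show ?thesis using w by blast
qed

lemma reconstructible_of_connected:
  assumes G: "is_graph G" and con: "k_connected (conn_bound + 1) G"
  shows "reconstructible M G"
  unfolding reconstructible_def
proof (intro allI impI)
  fix H \<psi>
  assume "is_graph H \<and> matroid_iso \<psi> G (M G) H (M H)"
  then have H: "is_graph H" and iso: "matroid_iso \<psi> G (M G) H (M H)" by auto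
  have im: "\<psi> ` G = H" using iso unfolding matroid_iso_def bij_betw_def by simp
  have "\<forall>v\<in>verts G. \<exists>w. w \<in> verts H \<and> (\<forall>e\<in>G. v \<in> e \<longleftrightarrow> w \<in> \<psi> e)"
    using star_image[OF G H iso con] by blast
  then obtain \<phi> where \<phi>H: "\<And>v. v \<in> verts G \<Longrightarrow> \<phi> v \<in> verts H"
    and \<phi>: "\<And>v e. v \<in> verts G \<Longrightarrow> e \<in> G \<Longrightarrow> v \<in> e \<longleftrightarrow> \<phi> v \<in> \<psi> e"
    by metis
  \<comment> \<open>If \<open>\<phi> u = \<phi> v\<close>, every edge at \<open>u\<close> contains
    \<open>v\<close> too, but two edges at \<open>u\<close> meet only in \<open>u\<close>.\<close>
  have inj: "inj_on \<phi> (verts G)"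
  proof (rule inj_onI)
    fix u v assume uv: "u \<in> verts G" "v \<in> verts G" "\<phi> u = \<phi> v"
    have "2 \<le> card (nbhd G u)"
      using k_connected_card_nbhd[OF G con uv(1)] c_pos unfolding conn_bound_def by simp
    then obtain x y where xy: "x \<in> nbhd G u" "y \<in> nbhd G u" "x \<noteq> y" using two_distinct by blast
    then have "{u, x} \<in> G" "{u, y} \<in> G" unfolding nbhd_def by auto
    then have "v \<in> {u, x}" "v \<in> {u, y}" using \<phi> uv by (metis insertI1)+
    then show "u = v" using xy(3) by auto
  qed
  have "\<phi> ` verts G = verts H"
  proof (rule card_subset_eq[OF finite_verts[OF H]])
    show "card (\<phi> ` verts G) = card (verts H)"
      using card_image[OF inj] iso_same_order[OF G H iso] k_connected_mono[OF con] by simp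
  qed (use \<phi>H in auto)
  then have bij: "bij_betw \<phi> (verts G) (verts H)" using inj unfolding bij_betw_def by simp
  have edge: "\<psi> {u, v} = {\<phi> u, \<phi> v}" if uv: "{u, v} \<in> G" for u v
  proof -
    have V: "u \<in> verts G" "v \<in> verts G" using uv unfolding verts_def by auto
    have "card {u, v} = 2" using G uv unfolding is_graph_def by blast
    then have "\<phi> u \<noteq> \<phi> v" using inj V unfolding inj_on_def by fastforce
    moreover have "\<phi> u \<in> \<psi> {u, v}" "\<phi> v \<in> \<psi> {u, v}" using \<phi>[OF V(1) uv] \<phi>[OF V(2) uv] by auto
    moreover have "card (\<psi> {u, v}) = 2" using H im uv unfolding is_graph_def by blast
    ultimately show ?thesis by (auto simp: card_2_iff)
  qed
  have "\<phi> ` e = \<psi> e" if e: "e \<in> G" for e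
  proof -
    obtain u v where "e = {u, v}" by (rule is_graph_edgeE[OF G e])
    then show ?thesis using edge[of u v] e by simp
  qed
  then have "(\<lambda>e. \<phi> ` e) ` G = H" using im image_cong[of G G "\<lambda>e. \<phi> ` e" \<psi>] by simp
  then show "\<exists>\<phi>. graph_iso \<phi> G H \<and> (\<forall>u v. {u, v} \<in> G \<longrightarrow> \<psi> {u, v} = {\<phi> u, \<phi> v})"
    unfolding graph_iso_def using bij edge by blast
qed

end

theorem theorem1p1:
  fixes M :: "graph \<Rightarrow> nat set set \<Rightarrow> bool"
  assumes "graph_matroid_family M" and "unbounded M"
  shows "whitney_property M \<longleftrightarrow> lovasz_yemini_property M"
proof
  interpret graph_matroids M using assms(1) by unfold_locales
  show "whitney_property M \<Longrightarrow> lovasz_yemini_property M" by (rule whitney_imp_lovasz_yemini)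
  assume ly: "lovasz_yemini_property M"
  then obtain c where c: "\<And>G. is_graph G \<Longrightarrow> k_connected c G \<Longrightarrow> rigid M G"
    unfolding lovasz_yemini_property_def by blast
  obtain N d where N: "\<And>n. N \<le> n \<Longrightarrow> kr (Suc n) = kr n + d" "1 \<le> d"
    using eventually_linear[OF ly assms(2)] by blast
  \<comment> \<open>Raising \<open>c\<close> to \<open>c + N + 1\<close> keeps the rigidity
    assumption and secures \<open>N_le_c\<close> and \<open>c_pos\<close>.\<close>
  interpret lovasz_yemini M d N "c + N + 1"
  proof unfold_locales
    fix G assume "is_graph G" "k_connected (c + N + 1) G"
    then show "rigid M G" using c k_connected_mono[of "c + N + 1" G c] by simp
  qed (use N in auto)
  show "whitney_property M"
    unfolding whitney_property_def using reconstructible_of_connected by blast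
qed

end
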